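(* Let $u\ge0$ be an integer. The group $\mathbb{Z}/4\mathbb{Z}\times\mathbb{Z}/2^{u}\mathbb{Z}$ is realisable (i.e. isomorphic to the group of units $A^*$ of some ring $A$) if and only if $u\le3$ or $2^u+1$ is a Fermat prime.
   Context: Rings are associative and unitary. A Fermat prime is a prime number of the form $2^u+1$ (necessarily with $u$ a power of $2$). *)

theory Defs
  imports "HOL-Algebra.Algebra"
begin

text \<open>
  HOL cannot quantify over all types inside a formula, so the type of the elements of the ring
  is a parameter. For a finite group this is no restriction, as long as the type is infinite:
  the subring generated by the units has the same units and is countable, hence has a copy in
  every infinite type; and every ring over a finite type also has a copy in every infinite type
  (lemma \<open>realisable_transfer\<close>).
\<close>

definition realisable :: "'r itself \<Rightarrow> ('g, 'm) monoid_scheme \<Rightarrow> bool" where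
  "realisable TYPE('r) G \<longleftrightarrow> (\<exists>A :: 'r ring. ring A \<and> G \<cong> units_of A)"

definition fermat_prime :: "nat \<Rightarrow> bool" where
  "fermat_prime p \<longleftrightarrow> Factorial_Ring.prime p \<and> (\<exists>k. p = 2 ^ k + 1)"

lemma realisable_transfer:
  assumes "inj (f :: 'a \<Rightarrow> 'b)" and "realisable TYPE('a) G"
  shows "realisable TYPE('b) G"
proof -
  obtain A :: "'a ring" where A: "ring A" "G \<cong> units_of A"
    using assms(2) unfolding realisable_def by blast
  have inj: "inj_on f (carrier A)"
    using assms(1) inj_on_subset by blast
  let ?B = "image_ring f A"
  have B: "ring ?B"
    using ring.inj_imp_image_ring_is_ring[OF A(1) inj] .
  have f: "f \<in> ring_iso A ?B"
    using inj_imp_image_ring_iso[OF inj] .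
  then have bij: "bij_betw f (carrier A) (carrier ?B)"
    and mult: "\<And>x y. x \<in> carrier A \<Longrightarrow> y \<in> carrier A \<Longrightarrow> f (x \<otimes>\<^bsub>A\<^esub> y) = f x \<otimes>\<^bsub>?B\<^esub> f y"
    and one: "f \<one>\<^bsub>A\<^esub> = \<one>\<^bsub>?B\<^esub>"
    by (auto simp: ring_iso_def ring_hom_def)
  have closed: "\<And>x y. x \<in> carrier A \<Longrightarrow> y \<in> carrier A \<Longrightarrow> x \<otimes>\<^bsub>A\<^esub> y \<in> carrier A"
    "\<one>\<^bsub>A\<^esub> \<in> carrier A"
    using A(1) by (auto intro: ring.ring_simprules)
  have unit: "f x \<in> Units ?B \<longleftrightarrow> x \<in> Units A" if "x \<in> carrier A" for x
  proof -
    have eq: "f a \<otimes>\<^bsub>?B\<^esub> f b = \<one>\<^bsub>?B\<^esub> \<longleftrightarrow> a \<otimes>\<^bsub>A\<^esub> b = \<one>\<^bsub>A\<^esub>"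
      if "a \<in> carrier A" "b \<in> carrier A" for a b
      using that mult[OF that] one closed inj_onD[OF inj] by metis
    have car: "carrier ?B = f ` carrier A"
      using bij by (simp add: bij_betw_def)
    show ?thesis
      unfolding Units_def car using that eq by auto
  qed
  have Units_sub: "Units A \<subseteq> carrier A"
    by (auto simp: Units_def)
  have "f ` Units A = Units ?B"
  proof
    show "f ` Units A \<subseteq> Units ?B"
      using unit by (auto simp: Units_def)
    show "Units ?B \<subseteq> f ` Units A"
    proof
      fix y assume y: "y \<in> Units ?B"
      then have "y \<in> carrier ?B" by (simp add: Units_def)
      then obtain x where "x \<in> carrier A" "y = f x"
        using bij by (auto simp: bij_betw_def)
      then show "y \<in> f ` Units A" using unit y by blast
    qed
  qed
  then have "f \<in> iso (units_of A) (units_of ?B)"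
    using mult inj_on_subset[OF inj Units_sub] Units_sub
    by (auto simp: iso_iff hom_def units_of_def)
  then have "units_of A \<cong> units_of ?B"
    by (rule is_isoI)
  with A(2) have "G \<cong> units_of ?B"
    by (rule iso_trans)
  with B show ?thesis
    unfolding realisable_def by blast
qed

end

theory Submission
  imports
    Defs
    "HOL-Number_Theory.Number_Theory"
    "HOL-Computational_Algebra.Computational_Algebra"
    "HOL-Computational_Algebra.Field_as_Ring"
begin

text \<open>
  If \<open>2 ^ u + 1\<close> is a prime or equals 9, the product of the field with five elements and a field
  with \<open>2 ^ u + 1\<close> elements has the required units, because finite fields have cyclic unit groups. For
  \<open>u \<le> 3\<close> the number \<open>2 ^ u + 1\<close> is 2, 3, 5 or 9.

  Conversely let \<open>u \<ge> 4\<close> and let \<open>h\<close> and \<open>g\<close> generate the two factors, of order 4 and \<open>2 ^ u\<close>, of the unit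
  group of a ring. The subring that they generate is commutative and has the same units. It is the
  quotient of the integer polynomials in two variables by the ideal \<open>I\<close> of relations, so that the
  argument can be carried out with congruences modulo \<open>I\<close> in a commutative ring; all that is used
  is that every unit modulo \<open>I\<close> is a monomial in \<open>h\<close> and \<open>g\<close> and which monomials are 1 (locale \<open>monomial_units\<close>). The proof that
  \<open>2 ^ u + 1\<close> is a prime has two halves.

  Descent. Suppose that a power of 2 annihilates \<open>g ^ 2 ^ r - 1\<close>, where \<open>r \<ge> 3\<close>. Multiplying
  \<open>g ^ 2 ^ (r - 1) - 1\<close> by that power of 2 gives an element \<open>t\<close> on which \<open>g ^ 2 ^ (r - 1)\<close> acts as \<open>-1\<close>,
  that is, \<open>g\<close> acts as a primitive root of unity of order \<open>2 ^ r\<close>. On \<open>t\<close>, some positive power of the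
  cyclotomic unit \<open>1 + g + g\<^sup>2\<close> acts like a unit of the whole ring, which has finite order, whereas the
  cyclotomic unit has infinite order. So \<open>t\<close> is torsion (\<open>eigen_part_torsion\<close>). If its odd part
  is not zero, it has a multiple that is a nonzero idempotent \<open>e\<close> with \<open>p e = 0\<close> for an odd prime \<open>p\<close>
  (\<open>odd_torsion_idempotent\<close>). The units of the corner ring of \<open>e\<close> have an exponent that divides \<open>2 ^ u\<close>. This forces
  \<open>p = 2 ^ v + 1\<close>, and a Frobenius computation with the unit \<open>1 + x\<close>, where \<open>x\<close> is a power of \<open>g\<close>, excludes
  \<open>v < u\<close> (\<open>corner_fermat_prime_power_maximal\<close>); hence \<open>2 ^ u + 1 = p\<close> is a prime. If the odd part is
  zero, a power of 2 annihilates \<open>g ^ 2 ^ (r - 1) - 1\<close>, and the descent goes on.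

  End of the descent. It remains to exclude that a power of 2 annihilates \<open>g ^ 4 - 1\<close>. The group has
  only three involutions, and \<open>1 + z\<close> squares to 1 whenever \<open>2 z = 0\<close> and \<open>z\<^sup>2 = 0\<close>; so there are very
  few such \<open>z\<close>. If \<open>4 = 0\<close>, the powers of \<open>g - 1\<close> or of \<open>g\<^sup>2 - 1\<close>, and the multiples of 2, contain too many of them
  (\<open>four_not_zero\<close>). If \<open>4 \<noteq> 0\<close>, at most one of them is nonzero. Since every involution of the group is
  a square, there is a unit \<open>i\<close> with \<open>i\<^sup>2 = -1\<close>. Multiplication by \<open>1 + i\<close>, whose square is \<open>2 i\<close>, yields
  a second one unless \<open>2 (g ^ 4 - 1) = 0\<close>, and in that case the powers of \<open>g ^ 4 - 1\<close> and \<open>g - 1\<close> yield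
  it (\<open>fourth_power_not_two_power_torsion\<close>).
\<close>

section \<open>Powers of one plus x\<close>

lemma power_two_freshman:
  fixes x :: "'a::comm_ring_1"
  shows "\<exists>c. (1 + x) ^ 2 ^ k = 1 + x ^ 2 ^ k + 2 * x * c"
proof (induction k)
  case 0
  then show ?case by (intro exI[of _ 0]) simp
next
  case (Suc k)
  then obtain c where c: "(1 + x) ^ 2 ^ k = 1 + x ^ 2 ^ k + 2 * x * c" by blast
  define y where "y = x ^ (2 ^ k - 1)"
  have y: "x ^ 2 ^ k = x * y"
    unfolding y_def by (metis power_eq_if power_not_zero zero_neq_numeral)
  have double: "z ^ 2 ^ Suc k = (z ^ 2 ^ k)\<^sup>2" for z :: 'a
    by (simp add: mult.commute flip: power_mult)
  have "(1 + x) ^ 2 ^ Suc k = (1 + x * y + 2 * x * c)\<^sup>2"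
    unfolding double c y ..
  also have "\<dots> = 1 + (x * y)\<^sup>2 + 2 * x * (y + 2 * c + 2 * x * y * c + 2 * x * c * c)"
    by (simp add: power2_eq_square algebra_simps)
  also have "(x * y)\<^sup>2 = x ^ 2 ^ Suc k"
    unfolding double y ..
  finally show ?case by blast
qed

lemma power_prime_freshman:
  fixes x :: "'a::comm_ring_1"
  assumes "Factorial_Ring.prime p"
  shows "\<exists>c. (1 + x) ^ p ^ k = 1 + x ^ p ^ k + of_nat p * c"
proof (induction k)
  case 0
  then show ?case by (intro exI[of _ 0]) simp
next
  case (Suc k)
  have prime_case: "\<exists>c. (a + b) ^ p = a ^ p + b ^ p + of_nat p * c" for a b :: 'a
  proof -
    have p: "p > 0" using assms prime_gt_0_nat by blast
    have "(a + b) ^ p = (\<Sum>j\<le>p. of_nat (p choose j) * a ^ j * b ^ (p - j))"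
      by (rule binomial_ring)
    also have "\<dots> = (\<Sum>j\<in>insert 0 (insert p {0<..<p}). of_nat (p choose j) * a ^ j * b ^ (p - j))"
      using p by (intro sum.cong) auto
    also have "\<dots> = b ^ p + a ^ p + (\<Sum>j\<in>{0<..<p}. of_nat (p choose j) * a ^ j * b ^ (p - j))"
      using p by (simp add: algebra_simps)
    also have "(\<Sum>j\<in>{0<..<p}. of_nat (p choose j) * a ^ j * b ^ (p - j)) =
       (\<Sum>j\<in>{0<..<p}. of_nat p * (of_nat ((p choose j) div p) * a ^ j * b ^ (p - j)))"
    proof (intro sum.cong refl)
      fix j assume "j \<in> {0<..<p}"
      then have "p dvd (p choose j)"
        using assms by (intro dvd_choose_prime) auto
      then have "(of_nat (p choose j) :: 'a) = of_nat p * of_nat ((p choose j) div p)"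
        by (metis dvd_mult_div_cancel of_nat_mult)
      then show "of_nat (p choose j) * a ^ j * b ^ (p - j)
          = of_nat p * (of_nat ((p choose j) div p) * a ^ j * b ^ (p - j))"
        by (simp add: mult.assoc)
    qed
    also have "\<dots> = of_nat p * (\<Sum>j\<in>{0<..<p}. of_nat ((p choose j) div p) * a ^ j * b ^ (p - j))"
      by (simp add: sum_distrib_left)
    finally have "(a + b) ^ p = a ^ p + b ^ p
        + of_nat p * (\<Sum>j\<in>{0<..<p}. of_nat ((p choose j) div p) * a ^ j * b ^ (p - j))"
      by (simp only: add.commute)
    then show ?thesis by blast
  qed
  obtain c where c: "(1 + x) ^ p ^ k = 1 + x ^ p ^ k + of_nat p * c" using Suc by blast
  obtain d where d: "(1 + (x ^ p ^ k + of_nat p * c)) ^ p = 1 ^ p + (x ^ p ^ k + of_nat p * c) ^ p + of_nat p * d"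
    using prime_case by blast
  obtain f where f: "(x ^ p ^ k + of_nat p * c) ^ p = (x ^ p ^ k) ^ p + (of_nat p * c) ^ p + of_nat p * f"
    using prime_case by blast
  obtain p' where p': "p = Suc p'" using prime_gt_0_nat[OF assms] gr0_implies_Suc by blast
  have "(of_nat p * c) ^ p = of_nat p * (c * (of_nat p * c) ^ p')"
    by (subst p', simp add: mult.assoc)
  moreover have step: "z ^ p ^ Suc k = (z ^ p ^ k) ^ p" for z :: 'a
    by (simp add: mult.commute flip: power_mult)
  ultimately have "(1 + x) ^ p ^ Suc k = 1 + x ^ p ^ Suc k + of_nat p * (c * (of_nat p * c) ^ p' + f + d)"
    using d f unfolding step c by (simp add: algebra_simps)
  then show ?case by blast
qed

section \<open>Congruences modulo an ideal\<close>

text \<open>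
  Congruences modulo an ideal of a type-class ring replace equations in a quotient ring, whose type
  would depend on the ideal.
\<close>
locale congruence_ideal =
  fixes I :: "'p::comm_ring_1 set"
  assumes zero_mem: "0 \<in> I"
    and add_mem: "\<lbrakk>a \<in> I; b \<in> I\<rbrakk> \<Longrightarrow> a + b \<in> I"
    and mult_mem: "a \<in> I \<Longrightarrow> r * a \<in> I"
begin

definition cong_mod :: "'p \<Rightarrow> 'p \<Rightarrow> bool" (infix \<open>\<doteq>\<close> 50)
  where "a \<doteq> b \<longleftrightarrow> a - b \<in> I"

lemma uminus_mem: "a \<in> I \<Longrightarrow> - a \<in> I"
  using mult_mem[of a "-1"] by simp

lemma diff_mem: "\<lbrakk>a \<in> I; b \<in> I\<rbrakk> \<Longrightarrow> a - b \<in> I"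
  using add_mem[of a "- b"] uminus_mem by simp

lemma mem_combination1: "\<lbrakk>x \<in> I; a = r * x\<rbrakk> \<Longrightarrow> a \<in> I"
  by (simp add: mult_mem)

lemma mem_combination2: "\<lbrakk>x \<in> I; y \<in> I; a = r * x + s * y\<rbrakk> \<Longrightarrow> a \<in> I"
  by (simp add: mult_mem add_mem)

lemma mem_combination3: "\<lbrakk>x \<in> I; y \<in> I; z \<in> I; a = r * x + s * y + t * z\<rbrakk> \<Longrightarrow> a \<in> I"
  by (simp add: mult_mem add_mem)

lemma mem_power_mono: "\<lbrakk>x ^ i * z \<in> I; i \<le> j\<rbrakk> \<Longrightarrow> x ^ j * z \<in> I"
  using mult_mem[of "x ^ i * z" "x ^ (j - i)"]
  by (simp add: mult.assoc[symmetric] flip: power_add)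

lemma cong_refl [simp]: "a \<doteq> a"
  by (simp add: cong_mod_def zero_mem)

lemma cong_sym: "a \<doteq> b \<Longrightarrow> b \<doteq> a"
  unfolding cong_mod_def using uminus_mem[of "a - b"] by simp

lemma cong_trans [trans]: "\<lbrakk>a \<doteq> b; b \<doteq> c\<rbrakk> \<Longrightarrow> a \<doteq> c"
  unfolding cong_mod_def using add_mem[of "a - b" "b - c"] by simp

lemma cong_zero_iff: "a \<doteq> 0 \<longleftrightarrow> a \<in> I"
  by (simp add: cong_mod_def)

lemma cong_mem_iff: "a \<doteq> b \<Longrightarrow> a \<in> I \<longleftrightarrow> b \<in> I"
  using cong_trans cong_sym cong_zero_iff by metis

lemma cong_add: "\<lbrakk>a \<doteq> b; c \<doteq> d\<rbrakk> \<Longrightarrow> a + c \<doteq> b + d"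
  unfolding cong_mod_def using add_mem[of "a - b" "c - d"] by (simp add: algebra_simps)

lemma cong_diff: "\<lbrakk>a \<doteq> b; c \<doteq> d\<rbrakk> \<Longrightarrow> a - c \<doteq> b - d"
  unfolding cong_mod_def using diff_mem[of "a - b" "c - d"] by (simp add: algebra_simps)

lemma cong_mult: "\<lbrakk>a \<doteq> b; c \<doteq> d\<rbrakk> \<Longrightarrow> a * c \<doteq> b * d"
  unfolding cong_mod_def
  by (rule mem_combination2[of "a - b" "c - d" _ c b]) (auto simp: algebra_simps)

lemma cong_mult_left: "c \<doteq> d \<Longrightarrow> a * c \<doteq> a * d"
  by (simp add: cong_mult)

lemma cong_mult_right: "c \<doteq> d \<Longrightarrow> c * a \<doteq> d * a"
  by (simp add: cong_mult)

lemma cong_power: "a \<doteq> b \<Longrightarrow> a ^ k \<doteq> b ^ k"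
  by (induction k) (auto intro: cong_mult)

lemma cong_absorb_power: "e * x \<doteq> e * y \<Longrightarrow> e * x ^ k \<doteq> e * y ^ k"
proof (induction k)
  case (Suc k)
  have "e * x ^ Suc k = x ^ k * (e * x)" by (simp add: algebra_simps)
  also have "\<dots> \<doteq> x ^ k * (e * y)" by (rule cong_mult_left[OF Suc.prems])
  also have "\<dots> = (e * x ^ k) * y" by (simp add: algebra_simps)
  also have "\<dots> \<doteq> (e * y ^ k) * y" by (rule cong_mult_right) (use Suc in auto)
  also have "\<dots> = e * y ^ Suc k" by (simp add: algebra_simps)
  finally show ?case .
qed simp

lemma coprime_multiples_mem:
  assumes "of_int a * x \<in> I" "of_int b * x \<in> I" "coprime a b"
  shows "x \<in> I"
proof -
  obtain c d where "c * a + d * b = 1"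
    using assms(3) by (metis bezout_int coprime_imp_gcd_eq_1)
  then have "x = of_int c * (of_int a * x) + of_int d * (of_int b * x)"
    by (metis (no_types, opaque_lifting) distrib_right mult.assoc mult_1 of_int_1 of_int_add of_int_mult)
  then show ?thesis using mem_combination2[OF assms(1,2)] by blast
qed

end

section \<open>Rings whose units are the monomials in two generators\<close>

text \<open>
  The second assumption says that the monomials form a group of type \<open>\<int>/4 \<times> \<int>/2 ^ u\<close> modulo \<open>I\<close>.
\<close>
locale monomial_units = congruence_ideal I for I :: "'p::comm_ring_1 set" +
  fixes g h :: 'p and u :: nat
  assumes unit_monomial: "c * d \<doteq> 1 \<Longrightarrow> \<exists>i j. c \<doteq> h ^ i * g ^ j"
    and monomial_one_iff: "h ^ i * g ^ j \<doteq> 1 \<longleftrightarrow> 4 dvd i \<and> 2 ^ u dvd j"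
    and large: "4 \<le> u"
begin

lemma g_power_one_iff: "g ^ j \<doteq> 1 \<longleftrightarrow> 2 ^ u dvd j"
  using monomial_one_iff[of 0 j] by simp

lemma g_unit: "g * g ^ (2 ^ u - 1) \<doteq> 1"
  using g_power_one_iff[of "2 ^ u"] by (metis dvd_refl power_eq_if power_not_zero zero_neq_numeral)

lemma cong_one_power_mod:
  assumes "x ^ m \<doteq> 1"
  shows "x ^ j \<doteq> x ^ (j mod m)"
proof -
  have "x ^ j = (x ^ m) ^ (j div m) * x ^ (j mod m)"
    by (metis mult_div_mod_eq power_add power_mult)
  also have "\<dots> \<doteq> 1 ^ (j div m) * x ^ (j mod m)"
    by (intro cong_mult_right cong_power assms)
  finally show ?thesis by simp
qed

lemma unit_power:
  assumes "c * d \<doteq> 1"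
  shows "c ^ 2 ^ u \<doteq> 1"
proof -
  obtain i j where "c \<doteq> h ^ i * g ^ j" using unit_monomial assms by blast
  then have "c ^ 2 ^ u \<doteq> h ^ (i * 2 ^ u) * g ^ (j * 2 ^ u)"
    using cong_power[of c "h ^ i * g ^ j" "2 ^ u"] by (simp add: power_mult_distrib power_mult)
  moreover have "4 dvd i * 2 ^ u"
    using le_imp_power_dvd[of 2 u "2::nat"] large by (simp add: dvd_mult)
  ultimately show ?thesis
    using monomial_one_iff by (meson cong_trans dvd_triv_right)
qed

text \<open>
  Fourth powers lie in the group generated by \<open>g ^ 4\<close>, because \<open>h ^ 4\<close> is 1, and a cyclic group has
  at most one involution.
\<close>
lemma fourth_power_involution:
  assumes "c ^ 8 \<doteq> 1" "\<not> c ^ 4 \<doteq> 1"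
  shows "c ^ 4 \<doteq> g ^ 2 ^ (u - 1)"
proof -
  have "c * c ^ 7 \<doteq> 1" using assms(1) by (simp add: eval_nat_numeral)
  then obtain i j where ij: "c \<doteq> h ^ i * g ^ j" using unit_monomial by blast
  have pow: "c ^ k \<doteq> h ^ (k * i) * g ^ (k * j)" for k
    using cong_power[OF ij, of k] by (simp add: power_mult_distrib mult.commute flip: power_mult)
  have "2 ^ u dvd 8 * j" using pow[of 8] assms(1) cong_sym cong_trans monomial_one_iff by blast
  moreover have "\<not> 2 ^ u dvd 4 * j"
    using pow[of 4] assms(2) cong_sym cong_trans monomial_one_iff by (metis dvd_triv_left)
  moreover have u: "(2::nat) ^ u = 2 * 2 ^ (u - 1)" using large by (cases u) auto
  ultimately have odd: "2 ^ (u - 1) dvd 4 * j" "\<not> 2 * 2 ^ (u - 1) dvd 4 * j"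
    by (auto simp: mult.assoc[of 2 4, simplified])
  then obtain k where k: "4 * j = 2 ^ (u - 1) * k" by blast
  have "odd k"
  proof
    assume "even k"
    then obtain k' where "k = 2 * k'" by blast
    with k odd(2) show False by (simp add: ac_simps)
  qed
  then have "k mod 2 = 1" by (simp only: odd_iff_mod_2_eq_one)
  moreover have "4 * j mod 2 ^ u = 2 ^ (u - 1) * (k mod 2)"
    unfolding k u by (metis mult.commute mult_mod_right)
  ultimately have "4 * j mod 2 ^ u = 2 ^ (u - 1)" by simp
  moreover have "g ^ (4 * j) \<doteq> g ^ (4 * j mod 2 ^ u)"
    by (intro cong_one_power_mod) (simp add: g_power_one_iff)
  ultimately have "g ^ (4 * j) \<doteq> g ^ 2 ^ (u - 1)" by simp
  moreover have "h ^ (4 * i) \<doteq> 1" using monomial_one_iff[of "4 * i" 0] by simp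
  ultimately have "h ^ (4 * i) * g ^ (4 * j) \<doteq> 1 * g ^ 2 ^ (u - 1)"
    by (rule cong_mult[rotated])
  with cong_trans[OF pow[of 4]] show ?thesis by simp
qed

text \<open>
  An involution has even exponents: \<open>i\<close> is divisible by 2 and \<open>j\<close> by \<open>2 ^ (u - 1)\<close>. So there are four
  square roots of 1, and each of them is the square of a unit.
\<close>
lemma involution_cases:
  assumes "c * c \<doteq> 1"
  obtains a b where "a < 2" "b < 2" "c \<doteq> (h ^ a * g ^ (b * 2 ^ (u - 2)))\<^sup>2"
proof -
  obtain i j where ij: "c \<doteq> h ^ i * g ^ j" using unit_monomial assms by blast
  have "h ^ (2 * i) * g ^ (2 * j) \<doteq> c * c"
    using cong_sym[OF cong_mult[OF ij ij]] unfolding mult_2 power_add by (simp add: ac_simps)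
  then have "h ^ (2 * i) * g ^ (2 * j) \<doteq> 1" using assms cong_trans by blast
  then have "4 dvd 2 * i" "2 ^ u dvd 2 * j" using monomial_one_iff by auto
  moreover have u: "(2::nat) ^ u = 2 * (2 * 2 ^ (u - 2))"
  proof -
    have "u = Suc (Suc (u - 2))" using large by simp
    then show ?thesis by (metis power_Suc)
  qed
  ultimately obtain a' b' where a': "i = 2 * a'" and b': "j = 2 * 2 ^ (u - 2) * b'"
    by (auto elim!: dvdE)
  have h4: "h ^ 4 \<doteq> 1" and gn: "g ^ 2 ^ u \<doteq> 1"
    using monomial_one_iff[of 4 0] monomial_one_iff[of 0 "2 ^ u"] by auto
  have "i mod 4 = 2 * (a' mod 2)" unfolding a' by presburger
  moreover have "j mod 2 ^ u = 2 * 2 ^ (u - 2) * (b' mod 2)"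
    unfolding b' u by (metis mult.assoc mult.commute mult_mod_right)
  ultimately have "h ^ i * g ^ j \<doteq> h ^ (2 * (a' mod 2)) * g ^ (2 * 2 ^ (u - 2) * (b' mod 2))"
    by (metis cong_mult cong_one_power_mod h4 gn)
  also have "\<dots> = (h ^ (a' mod 2) * g ^ ((b' mod 2) * 2 ^ (u - 2)))\<^sup>2"
    by (simp add: power_mult_distrib mult.commute mult.left_commute flip: power_mult)
  finally have "c \<doteq> (h ^ (a' mod 2) * g ^ ((b' mod 2) * 2 ^ (u - 2)))\<^sup>2"
    using ij cong_trans by blast
  then show ?thesis using that[of "a' mod 2" "b' mod 2"] by simp
qed

lemma involution_square: "c * c \<doteq> 1 \<Longrightarrow> \<exists>y. c \<doteq> y\<^sup>2"
  using involution_cases by metis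

text \<open>
  Stated for lists of pairwise incongruent elements, so that five explicit square roots of 1 lead to
  a contradiction by simplification.
\<close>
lemma at_most_four_involutions:
  assumes "\<forall>w\<in>set ws. w * w \<doteq> 1" and "4 < length ws"
  shows "\<not> sorted_wrt (\<lambda>a b. \<not> a \<doteq> b) ws"
proof
  assume incong: "sorted_wrt (\<lambda>a b. \<not> a \<doteq> b) ws"
  have "\<forall>k\<in>{..<length ws}. \<exists>s\<in>{..<2} \<times> {..<2}. ws ! k \<doteq> (h ^ fst s * g ^ (snd s * 2 ^ (u - 2)))\<^sup>2"
  proof
    fix k assume "k \<in> {..<length ws}"
    then have "ws ! k * ws ! k \<doteq> 1" using assms(1) by simp
    then show "\<exists>s\<in>{..<2} \<times> {..<2}. ws ! k \<doteq> (h ^ fst s * g ^ (snd s * 2 ^ (u - 2)))\<^sup>2"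
    proof (rule involution_cases)
      fix a b :: nat
      assume "a < 2" "b < 2" "ws ! k \<doteq> (h ^ a * g ^ (b * 2 ^ (u - 2)))\<^sup>2"
      then show ?thesis by (intro bexI[of _ "(a, b)"]) auto
    qed
  qed
  then obtain f where f: "\<And>k. k < length ws \<Longrightarrow> f k \<in> {..<2} \<times> {..<2::nat}"
    "\<And>k. k < length ws \<Longrightarrow> ws ! k \<doteq> (h ^ fst (f k) * g ^ (snd (f k) * 2 ^ (u - 2)))\<^sup>2"
    by (metis bchoice lessThan_iff)
  have "\<not> inj_on f {..<length ws}"
  proof
    assume "inj_on f {..<length ws}"
    then have "card {..<length ws} \<le> card ({..<2::nat} \<times> {..<2::nat})"
      using f(1) by (intro card_inj_on_le[of f] image_subsetI) auto
    then show False using assms(2) by simp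
  qed
  then obtain k l where "k < l" "l < length ws" "f k = f l"
    using that unfolding inj_on_def lessThan_iff by (metis (full_types) lessThan_iff linorder_neqE_nat)
  then have "ws ! k \<doteq> ws ! l"
    using f(2)[of k] f(2)[of l] cong_sym cong_trans by (metis order_less_trans)
  then show False using incong \<open>k < l\<close> \<open>l < length ws\<close> by (simp add: sorted_wrt_iff_nth_less)
qed

end

context monomial_units
begin

section \<open>Square-zero elements of additive order two\<close>

definition square_zero :: "'p set"
  where "square_zero = {z. 2 * z \<in> I \<and> z * z \<in> I}"

lemma square_zeroI: "\<lbrakk>2 * z \<in> I; z * z \<in> I\<rbrakk> \<Longrightarrow> z \<in> square_zero"
  and square_zeroD: "z \<in> square_zero \<Longrightarrow> 2 * z \<in> I" "z \<in> square_zero \<Longrightarrow> z * z \<in> I"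
  by (simp_all add: square_zero_def)

lemma square_zero_add:
  assumes "z \<in> square_zero" "w \<in> square_zero"
  shows "z + w \<in> square_zero"
proof (rule square_zeroI)
  show "2 * (z + w) \<in> I"
    by (rule mem_combination2[OF square_zeroD(1)[OF assms(1)] square_zeroD(1)[OF assms(2)], of _ 1 1])
      (simp add: algebra_simps)
  show "(z + w) * (z + w) \<in> I"
    by (rule mem_combination3[OF square_zeroD(2)[OF assms(1)] square_zeroD(2)[OF assms(2)]
        square_zeroD(1)[OF assms(1)], of _ 1 1 w]) (simp add: algebra_simps)
qed

lemma square_zero_mult:
  assumes "z \<in> square_zero"
  shows "y * z \<in> square_zero"
proof (rule square_zeroI)
  show "2 * (y * z) \<in> I"
    by (rule mem_combination1[OF square_zeroD(1)[OF assms], of _ y]) (simp add: algebra_simps)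
  show "y * z * (y * z) \<in> I"
    by (rule mem_combination1[OF square_zeroD(2)[OF assms], of _ "y * y"]) (simp add: algebra_simps)
qed

lemma square_zero_involution:
  assumes "z \<in> square_zero"
  shows "(1 + z) * (1 + z) \<doteq> 1"
  unfolding cong_mod_def
  by (rule mem_combination2[OF square_zeroD(1)[OF assms] square_zeroD(2)[OF assms], of _ 1 1])
    (simp add: algebra_simps)

text \<open>
  The sums of \<open>v\<close>, \<open>y v\<close> and \<open>y\<^sup>2 v\<close> are square-zero elements if \<open>v\<close> is one. If \<open>y\<close> acts nilpotently and
  \<open>y\<^sup>2 v\<close> is the last nonzero term, these elements are independent, so that \<open>1 + z\<close> takes
  more than four values on them; but 1 has only four square roots.
\<close>
lemma square_zero_length_le_two:
  assumes z: "z \<in> square_zero" and nilp: "y ^ k * z \<in> I"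
  shows "y ^ 2 * z \<in> I"
proof (rule ccontr)
  assume not2: "y ^ 2 * z \<notin> I"
  define m where "m = (LEAST m. y ^ m * z \<in> I)"
  have m: "y ^ m * z \<in> I" unfolding m_def using nilp by (rule LeastI)
  have below: "y ^ i * z \<notin> I" if "i < m" for i
    using that unfolding m_def by (rule not_less_Least)
  have m3: "3 \<le> m"
  proof (rule ccontr)
    assume "\<not> 3 \<le> m"
    then show False using mem_power_mono[OF m, of 2] not2 by simp
  qed
  define v where "v = y ^ (m - 3) * z"
  have shift: "y ^ i * v = y ^ (i + (m - 3)) * z" for i
    by (simp add: v_def power_add mult.assoc)
  have v: "v \<in> square_zero" unfolding v_def by (rule square_zero_mult[OF z])
  have v3: "y ^ 3 * v \<in> I" using shift[of 3] m m3 by simp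
  have v2: "y ^ 2 * v \<notin> I" using shift[of 2] below[of "2 + (m - 3)"] m3 by simp
  have generates: "d \<notin> I" if "y ^ 2 * v = r * d + s * (y ^ 3 * v)" for d r s
    using v2 mem_combination2[OF _ v3 that] by blast
  note alg = algebra_simps power2_eq_square power3_eq_cube
  \<comment> \<open>Every difference of two of these five square roots of 1 has \<open>y\<^sup>2 v\<close> as a multiple modulo \<open>y\<^sup>3 v\<close>.\<close>
  have "\<not> sorted_wrt (\<lambda>a b. \<not> a \<doteq> b)
      [1, 1 + v, 1 + y * v, 1 + y ^ 2 * v, 1 + (v + y ^ 2 * v)]"
    using v square_zero_mult[OF v]
    by (intro at_most_four_involutions) (auto intro!: square_zero_involution square_zero_add)
  moreover have "sorted_wrt (\<lambda>a b. \<not> a \<doteq> b)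
      [1, 1 + v, 1 + y * v, 1 + y ^ 2 * v, 1 + (v + y ^ 2 * v)]"
  proof -
    have "- v \<notin> I" by (rule generates[of "- (y ^ 2)" _ 0]) (simp add: alg)
    moreover have "- (y * v) \<notin> I" by (rule generates[of "- y" _ 0]) (simp add: alg)
    moreover have "- (y\<^sup>2 * v) \<notin> I" by (rule generates[of "- 1" _ 0]) (simp add: alg)
    moreover have "- v - y\<^sup>2 * v \<notin> I" by (rule generates[of "- (y ^ 2)" _ "- y"]) (simp add: alg)
    moreover have "v - y * v \<notin> I" by (rule generates[of "y ^ 2" _ 1]) (simp add: alg)
    moreover have "v - y\<^sup>2 * v \<notin> I" by (rule generates[of "y ^ 2" _ y]) (simp add: alg)
    moreover have "y * v - y\<^sup>2 * v \<notin> I" by (rule generates[of y _ 1]) (simp add: alg)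
    moreover have "y * v - (v + y\<^sup>2 * v) \<notin> I"
      by (rule generates[of "- (y ^ 2)" _ "1 - y"]) (simp add: alg)
    ultimately show ?thesis by (simp add: cong_mod_def)
  qed
  ultimately show False by blast
qed

text \<open>
  Let \<open>x ^ m\<close> be the first power that vanishes. If \<open>m \<ge> 6\<close>, then \<open>x ^ (m - 3)\<close> has square zero, and
  it survives two further multiplications by \<open>x\<close>.
\<close>
lemma nilpotent_of_order_two_fifth_power:
  assumes two: "2 * x \<in> I" and nilp: "x ^ k \<in> I"
  shows "x ^ 5 \<in> I"
proof (rule ccontr)
  assume not5: "x ^ 5 \<notin> I"
  define m where "m = (LEAST m. x ^ m \<in> I)"
  have m: "x ^ m \<in> I" unfolding m_def using nilp by (rule LeastI)
  have m6: "6 \<le> m"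
  proof (rule ccontr)
    assume "\<not> 6 \<le> m"
    then show False using mem_power_mono[of x m 1 5] m not5 by simp
  qed
  have "x ^ (m - 3) \<in> square_zero"
  proof (rule square_zeroI)
    have "x ^ (m - 3) = x ^ (m - 4) * x" 
    proof -
      have "m - 3 = Suc (m - 4)" using m6 by simp
      then show ?thesis by (simp add: mult.commute)
    qed
    then show "2 * x ^ (m - 3) \<in> I"
      by (intro mem_combination1[OF two, of _ "x ^ (m - 4)"]) simp
    show "x ^ (m - 3) * x ^ (m - 3) \<in> I"
      using mem_power_mono[of x m 1 "(m - 3) + (m - 3)"] m m6 by (simp flip: power_add)
  qed
  then have "x ^ 2 * x ^ (m - 3) \<in> I"
    by (rule square_zero_length_le_two[of _ _ 3]) (use m m6 in \<open>simp flip: power_add\<close>)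
  moreover have "x ^ 2 * x ^ (m - 3) = x ^ (m - 1)"
  proof -
    have "2 + (m - 3) = m - 1" using m6 by simp
    then show ?thesis by (metis power_add)
  qed
  ultimately have "x ^ (m - 1) \<in> I" by simp
  then show False using not_less_Least[of "m - 1" "\<lambda>m. x ^ m \<in> I"] m6 unfolding m_def by simp
qed

lemma g_involution: "\<not> g ^ 2 ^ (u - 1) \<doteq> 1" "g ^ 2 ^ u \<doteq> 1"
  using large by (auto simp: g_power_one_iff dest!: dvd_imp_le)

section \<open>Characteristic two and four\<close>

text \<open>
  Assume \<open>4 = 0\<close> and write \<open>g = 1 + x\<close>; then \<open>x\<close> is nilpotent, and \<open>2 x\<^sup>2 = 0\<close> because 2 is a square-zero
  element. If \<open>2 x = 0\<close>, Frobenius gives \<open>x ^ 2 ^ (u - 1) \<noteq> 0\<close>, but already \<open>x ^ 5\<close> vanishes. If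
  \<open>2 x \<noteq> 0\<close>, the same argument for \<open>q = g\<^sup>2 - 1\<close>, with half the exponent, leaves only the possibility
  \<open>q ^ 4 \<noteq> 0 = q ^ 5\<close>. Then 0, 2, \<open>2 x\<close>, \<open>2 + 2 x\<close> and \<open>q\<^sup>3\<close> are five square-zero elements; the last one
  differs from the others because \<open>q\<close> annihilates them.
\<close>
lemma four_not_zero: "4 \<notin> I"
proof
  assume four: "4 \<in> I"
  define x where "x = g - 1"
  have g: "g = 1 + x" by (simp add: x_def)
  obtain c where c: "g ^ 2 ^ u = 1 + x ^ 2 ^ u + 2 * x * c"
    unfolding g using power_two_freshman by blast
  have "x ^ 2 ^ u + 2 * x * c \<in> I"
    using g_involution(2) unfolding cong_mod_def c by (simp add: algebra_simps)
  then have "x ^ 2 ^ u * x ^ 2 ^ u \<in> I"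
    by (rule mem_combination2[OF _ four, of _ _ "x ^ 2 ^ u - 2 * x * c" "x * c * (x * c)"])
      (simp add: algebra_simps)
  then have nilp: "x ^ (2 ^ u + 2 ^ u) \<in> I" by (simp add: power_add)
  have "2 \<in> square_zero" using four by (intro square_zeroI) auto
  then have "x ^ 2 * 2 \<in> I"
    by (rule square_zero_length_le_two[of _ _ "2 ^ u + 2 ^ u"])
      (rule mem_combination1[OF nilp, of _ 2], simp)
  then have x2: "2 * x ^ 2 \<in> I" by (simp add: mult.commute)
  have frob: "y ^ 2 ^ k \<in> I \<longleftrightarrow> (1 + y) ^ 2 ^ k \<doteq> 1" if "2 * y \<in> I" for y k
  proof -
    obtain d where d: "(1 + y) ^ 2 ^ k = 1 + y ^ 2 ^ k + 2 * y * d" using power_two_freshman by blast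
    have "(1 + y) ^ 2 ^ k - 1 \<doteq> y ^ 2 ^ k"
      unfolding d cong_mod_def by (rule mem_combination1[OF that, of _ d]) (simp add: algebra_simps)
    then show ?thesis by (simp add: cong_mem_iff cong_mod_def[of _ 1])
  qed
  show False
  proof (cases "2 * x \<in> I")
    case True
    have "x ^ 5 \<in> I" using True nilp by (rule nilpotent_of_order_two_fifth_power)
    moreover have "5 \<le> (2::nat) ^ (u - 1)"

    proof -
      have "(2::nat) ^ 3 \<le> 2 ^ (u - 1)" using large by (intro power_increasing) auto
      then show ?thesis by simp
    qed
    ultimately have "x ^ 2 ^ (u - 1) \<in> I" using mem_power_mono[of x 5 1] by simp
    then show False using g_involution(1) frob[OF True] unfolding g by blast
  next
    case False
    define q where "q = g ^ 2 - 1"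
    have q: "1 + q = g ^ 2" by (simp add: q_def)
    have q2: "2 * q \<in> I"
      by (rule mem_combination2[OF x2 four, of _ 1 x])
        (simp add: q_def g power2_eq_square algebra_simps)
    have level: "(1 + q) ^ 2 ^ (k - 1) = g ^ 2 ^ k" if "0 < k" for k
      unfolding q power_mult[symmetric] using that by (simp flip: power_Suc)
    have "q ^ 2 ^ (u - 1) \<in> I"
      using g_involution(2) frob[OF q2] level[of u] large by simp
    then have q5: "q ^ 5 \<in> I" using q2 nilpotent_of_order_two_fifth_power by blast
    have qn: "q ^ 2 ^ (u - 2) \<notin> I"
      using g_involution(1) frob[OF q2] level[of "u - 1"] large by (simp add: numeral_2_eq_2)
    have q4: "q ^ 4 \<notin> I"

    proof
      assume "q ^ 4 \<in> I"
      moreover have "(2::nat) ^ 2 \<le> 2 ^ (u - 2)" using large by (intro power_increasing) auto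
      ultimately show False using qn mem_power_mono[of q 4 1 "2 ^ (u - 2)"] by simp
    qed
    have q3: "q ^ 3 \<in> square_zero"
    proof (rule square_zeroI)
      show "2 * q ^ 3 \<in> I"
        by (rule mem_combination1[OF q2, of _ "q ^ 2"]) (simp add: eval_nat_numeral algebra_simps)
      show "q ^ 3 * q ^ 3 \<in> I"
        by (rule mem_combination1[OF q5, of _ q]) (simp add: eval_nat_numeral algebra_simps)
    qed
    have two: "2 \<notin> I" using False mult_mem[of 2 x] by (auto simp: mult.commute)
    have sz: "2 * d \<in> square_zero" for d
      using square_zero_mult[OF \<open>2 \<in> square_zero\<close>, of d] by (simp add: mult.commute)
    have "\<not> sorted_wrt (\<lambda>a b. \<not> a \<doteq> b)
        [1, 1 + 2 * 1, 1 + 2 * x, 1 + 2 * (1 + x), 1 + q ^ 3]"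
      using q3 sz by (intro at_most_four_involutions) (auto intro!: square_zero_involution
          simp del: mult_1_right distrib_left_numeral)
    moreover have "\<not> 1 + 2 * d \<doteq> 1 + q ^ 3" for d
    proof
      assume "1 + 2 * d \<doteq> 1 + q ^ 3"
      then have "2 * d - q ^ 3 \<in> I" by (simp add: cong_mod_def)
      then have "q ^ 4 \<in> I"
        by (rule mem_combination2[OF _ q2, of _ _ "- q" d]) (simp add: eval_nat_numeral algebra_simps)
      with q4 show False by blast
    qed
    from this[of 0] this[of 1] this[of x] this[of "1 + x"]
    have "\<not> 1 \<doteq> 1 + q ^ 3" "\<not> 1 + 2 * 1 \<doteq> 1 + q ^ 3" "\<not> 1 + 2 * x \<doteq> 1 + q ^ 3"
      "\<not> 1 + 2 * (1 + x) \<doteq> 1 + q ^ 3" by simp_all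
    moreover have "\<not> 1 \<doteq> 1 + 2 * 1" "\<not> 1 + 2 * x \<doteq> 1 + 2 * (1 + x)"
      using two uminus_mem[of "-2"] by (auto simp: cong_mod_def algebra_simps)
    moreover have "\<not> 1 \<doteq> 1 + 2 * x" "\<not> 1 + 2 * 1 \<doteq> 1 + 2 * (1 + x)"
      using False uminus_mem[of "- (2 * x)"] by (auto simp: cong_mod_def algebra_simps)
    moreover have "\<not> 1 \<doteq> 1 + 2 * (1 + x)"
    proof
      assume "1 \<doteq> 1 + 2 * (1 + x)"
      then have "- 2 * (1 + x) \<in> I" by (simp add: cong_mod_def algebra_simps)
      then have "2 * x \<in> I"
        by (rule mem_combination2[OF _ x2, of _ _ "- x" "-1"]) (simp add: algebra_simps power2_eq_square)
      with False show False ..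
    qed
    moreover have "\<not> 1 + 2 * 1 \<doteq> 1 + 2 * x"
    proof
      assume "1 + 2 * 1 \<doteq> 1 + 2 * x"
      then have "2 - 2 * x \<in> I" by (simp add: cong_mod_def algebra_simps)
      then have "2 * x \<in> I"
        by (rule mem_combination2[OF _ x2, of _ _ "x" "1"]) (simp add: algebra_simps power2_eq_square)
      with False show False ..
    qed
    ultimately show False by (simp del: mult_1_right distrib_left_numeral)
  qed
qed

section \<open>Two-power torsion\<close>

text \<open>
  With \<open>4 \<noteq> 0\<close> the involutions \<open>-1\<close> and \<open>- (1 + z)\<close> are not of the form \<open>1 + w\<close> for a square-zero element
  \<open>w\<close>, which leaves room for one nonzero square-zero element only.
\<close>
lemma square_zero_unique:
  assumes "z \<in> square_zero" "w \<in> square_zero" "z \<notin> I" "w \<notin> I"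
  shows "z \<doteq> w"
proof (rule ccontr)
  assume ne: "\<not> z \<doteq> w"
  have no: "d \<notin> I" if "4 = r * d + s * (2 * z) + t * (2 * w)" for d r s t
    using that four_not_zero square_zeroD(1)[OF assms(1)] square_zeroD(1)[OF assms(2)]
      mem_combination3 by blast
  have "\<not> sorted_wrt (\<lambda>a b. \<not> a \<doteq> b) [1, -1, 1 + z, 1 + w, - (1 + z)]"
    using square_zero_involution[OF assms(1)] square_zero_involution[OF assms(2)]
    by (intro at_most_four_involutions) (auto simp del: minus_add_distrib)
  moreover have "\<not> 1 \<doteq> -1" unfolding cong_mod_def by (rule no[of 2 _ 0 0]) simp
  moreover have "\<not> 1 \<doteq> - (1 + z)" unfolding cong_mod_def
    by (rule no[of 2 _ "-1" 0]) (simp add: algebra_simps)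
  moreover have "\<not> -1 \<doteq> 1 + z" unfolding cong_mod_def
    by (rule no[of "-2" _ "-1" 0]) (simp add: algebra_simps)
  moreover have "\<not> -1 \<doteq> 1 + w" unfolding cong_mod_def
    by (rule no[of "-2" _ 0 "-1"]) (simp add: algebra_simps)
  moreover have "\<not> 1 + z \<doteq> - (1 + z)" unfolding cong_mod_def
    by (rule no[of 2 _ "-2" 0]) (simp add: algebra_simps)
  moreover have "\<not> 1 + w \<doteq> - (1 + z)" unfolding cong_mod_def
    by (rule no[of 2 _ "-1" "-1"]) (simp add: algebra_simps)
  moreover have "\<not> 1 \<doteq> 1 + z" "\<not> -1 \<doteq> - (1 + z)" "\<not> 1 \<doteq> 1 + w"
    using assms(3,4) uminus_mem[of "- z"] uminus_mem[of "- w"] by (auto simp: cong_mod_def)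
  moreover have "\<not> 1 + z \<doteq> 1 + w" using ne by (simp add: cong_mod_def)
  ultimately show False by (simp del: minus_add_distrib)
qed

lemma square_zero_unit_mult:
  assumes "z \<in> square_zero" "y * y' \<doteq> 1"
  shows "y * z \<doteq> z"
proof (cases "z \<in> I")
  case True
  then show ?thesis using cong_zero_iff mult_mem cong_sym cong_trans by blast
next
  case False
  have "y' * (y * z) \<doteq> z"
    using cong_mult_right[OF assms(2), of z] by (simp add: ac_simps)
  then have "y * z \<notin> I" using False mult_mem cong_mem_iff by blast
  then show ?thesis using square_zero_unique square_zero_mult assms(1) False by blast
qed

text \<open>
  There is a unit \<open>i\<close> with \<open>i\<^sup>2 = -1\<close>, because every involution is a square. Units fix every
  square-zero element, so \<open>l = 1 + i\<close>, \<open>g - 1\<close> and \<open>y = g ^ 4 - 1\<close> annihilate it. If \<open>2 y \<noteq> 0\<close>, the last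
  two nonzero elements among the \<open>l ^ k y\<close> are both square-zero, although \<open>l\<close> maps one to the other,
  a contradiction. If \<open>2 y = 0\<close>, then
  \<open>g ^ 2 ^ (u - 1) - 1\<close> is a nonzero square-zero element, equal to \<open>y ^ L\<close> with \<open>L = 2 ^ (u - 3)\<close>, and
  \<open>y ^ (L - 1) (g - 1)\<^sup>2\<close> is a square-zero element that \<open>g - 1\<close> does not annihilate.
\<close>
lemma fourth_power_not_two_power_torsion: "2 ^ j * (g ^ 4 - 1) \<notin> I"
proof
  assume torsion: "2 ^ j * (g ^ 4 - 1) \<in> I"
  define y where "y = g ^ 4 - 1"
  have "(-1) * (-1) \<doteq> (1 :: 'p)" by simp
  then obtain i where i: "- 1 \<doteq> i\<^sup>2" using involution_square by blast
  define l where "l = 1 + i"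
  have ii: "i\<^sup>2 + 1 \<in> I" using cong_sym[OF i] by (simp add: cong_mod_def)
  have l2: "l\<^sup>2 \<doteq> 2 * i" unfolding cong_mod_def
    by (rule mem_combination1[OF ii, of _ 1]) (simp add: l_def power2_eq_square algebra_simps)
  have i_unit: "i * (- i) \<doteq> 1" unfolding cong_mod_def
    by (rule mem_combination1[OF ii, of _ "-1"]) (simp add: power2_eq_square algebra_simps)
  have l_kills: "l * z \<in> I" if "z \<in> square_zero" for z
  proof -
    have "l * z = z + i * z" by (simp add: l_def algebra_simps)
    also have "\<dots> \<doteq> z + z" by (intro cong_add square_zero_unit_mult[OF that i_unit]) simp
    also have "z + z = 2 * z" by simp
    finally show ?thesis using cong_mem_iff square_zeroD(1)[OF that] by blast
  qed
  have y_kills: "y * z \<in> I" if "z \<in> square_zero" for z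
  proof -
    have "g ^ 4 * (g ^ (2 ^ u - 1)) ^ 4 \<doteq> 1"
      using cong_power[OF g_unit, of 4] by (simp add: power_mult_distrib)
    then have "g ^ 4 * z \<doteq> z" by (rule square_zero_unit_mult[OF that])
    then show ?thesis by (simp add: y_def cong_mod_def algebra_simps)
  qed
  have l2j: "l ^ (2 * k) \<doteq> 2 ^ k * i ^ k" for k
    using cong_power[OF l2, of k] by (simp add: power_mult power_mult_distrib)
  have l2y: "l ^ 2 * w \<in> I \<longleftrightarrow> 2 * w \<in> I" for w
  proof
    assume "l ^ 2 * w \<in> I"
    then have "2 * i * w \<in> I" using cong_mem_iff[OF cong_mult_right[OF l2]] by blast
    then show "2 * w \<in> I"
      by (rule mem_combination2[OF _ ii, of _ _ "- i" "2 * w"]) (simp add: algebra_simps power2_eq_square)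
  next
    assume "2 * w \<in> I"
    then have "2 * i * w \<in> I" using mult_mem[of "2 * w" i] by (simp add: ac_simps)
    then show "l ^ 2 * w \<in> I" using cong_mem_iff[OF cong_mult_right[OF l2]] by blast
  qed
  have y2: "2 * y \<in> I"
  proof (rule ccontr)
    assume not2: "2 * y \<notin> I"
    define m where "m = (LEAST m. l ^ m * y \<in> I)"
    have "l ^ (2 * j) * y \<doteq> i ^ j * (2 ^ j * y)"
      using cong_mult_right[OF l2j[of j], of y] by (simp add: ac_simps)
    then have "l ^ (2 * j) * y \<in> I" using torsion mult_mem cong_mem_iff y_def by blast
    then have m: "l ^ m * y \<in> I" unfolding m_def by (rule LeastI)
    have m3: "3 \<le> m"
    proof (rule ccontr)
      assume "\<not> 3 \<le> m"
      then have "l ^ 2 * y \<in> I" using mem_power_mono[OF m, of 2] by simp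
      then show False using not2 l2y by blast
    qed
    then obtain k where k: "m = Suc (Suc (Suc k))" by (metis le_Suc_ex numeral_3_eq_3 add_Suc)
    have m': "l ^ 2 * (l ^ Suc k * y) \<in> I" using m by (simp add: k ac_simps power2_eq_square)
    have "l ^ 2 * (l ^ Suc (Suc k) * y) \<in> I" using mult_mem[OF m', of l] by (simp add: ac_simps)
    then have "2 * (l ^ Suc (Suc k) * y) \<in> I" using l2y by blast
    moreover have "(l ^ Suc (Suc k) * y) * (l ^ Suc (Suc k) * y) \<in> I"
      by (rule mem_combination1[OF m', of _ "l ^ Suc k * y"]) (simp add: ac_simps power2_eq_square)
    ultimately have "l ^ Suc (Suc k) * y \<in> square_zero" by (rule square_zeroI)
    then have yz: "y * (l ^ Suc (Suc k) * y) \<in> I" by (rule y_kills)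
    have "(l ^ Suc k * y) * (l ^ Suc k * y) \<in> I"
      by (rule mem_combination1[OF yz, of _ "l ^ k"]) (simp add: ac_simps)
    moreover have "2 * (l ^ Suc k * y) \<in> I" using m' l2y by blast
    ultimately have "l ^ Suc k * y \<in> square_zero" by (intro square_zeroI)
    then have "l * (l ^ Suc k * y) \<in> I" by (rule l_kills)
    then have "l ^ Suc (Suc k) * y \<in> I" by (simp add: ac_simps)
    then show False using not_less_Least[of "Suc (Suc k)" "\<lambda>m. l ^ m * y \<in> I"] k unfolding m_def by simp
  qed
  define L :: nat where "L = 2 ^ (u - 3)"
  obtain L' where L': "L = Suc (Suc L')"
  proof -
    have "(2::nat) ^ 1 \<le> 2 ^ (u - 3)" using large by (intro power_increasing) auto
    then have "2 \<le> L" by (simp add: L_def)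
    then show ?thesis using that by (metis add_2_eq_Suc le_Suc_ex)
  qed
  have "(1 + y) ^ L = g ^ 2 ^ (u - 1)"
  proof -
    have "(4::nat) * 2 ^ (u - 3) = 2 ^ (u - 1)"
    proof -
      have "u - 1 = Suc (Suc (u - 3))" using large by simp
      then show ?thesis by simp
    qed
    then show ?thesis by (simp add: y_def L_def flip: power_mult)
  qed
  moreover obtain c where "(1 + y) ^ L = 1 + y ^ L + 2 * y * c"
    unfolding L_def using power_two_freshman by blast
  ultimately have "y ^ L \<doteq> g ^ 2 ^ (u - 1) - 1"
    unfolding cong_mod_def by (intro mem_combination1[OF y2, of _ "- c"]) (simp add: algebra_simps)
  then have yL: "y ^ L \<notin> I"
    using g_involution(1) cong_mem_iff unfolding cong_mod_def[of _ 1] by blast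
  have y2L: "y ^ (L + L) \<in> I"
  proof -
    have "(1 + y) ^ 2 ^ (u - 2) = g ^ 2 ^ u"
    proof -
      have "u = Suc (Suc (u - 2))" using large by simp
      then have "(4::nat) * 2 ^ (u - 2) = 2 ^ u" by (metis mult_2 power_Suc mult.assoc numeral_Bit0 mult_numeral_1 add_mult_distrib)
      then show ?thesis by (simp add: y_def flip: power_mult)
    qed
    moreover obtain c where "(1 + y) ^ 2 ^ (u - 2) = 1 + y ^ 2 ^ (u - 2) + 2 * y * c"
      using power_two_freshman by blast
    ultimately have "y ^ 2 ^ (u - 2) \<doteq> g ^ 2 ^ u - 1"
      unfolding cong_mod_def by (intro mem_combination1[OF y2, of _ "- c"]) (simp add: algebra_simps)
    moreover have "L + L = 2 ^ (u - 2)"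
    proof -
      have "u - 2 = Suc (u - 3)" using large by simp
      then show ?thesis by (simp add: L_def)
    qed
    ultimately show ?thesis
      using g_involution(2) cong_mem_iff unfolding cong_mod_def[of _ 1] by metis
  qed
  have yL_sz: "y ^ L \<in> square_zero"
  proof (rule square_zeroI)
    show "2 * y ^ L \<in> I"
      by (rule mem_combination1[OF y2, of _ "y ^ Suc L'"]) (simp add: L' ac_simps)
  qed (use y2L in \<open>simp add: power_add\<close>)
  define x where "x = g - 1"
  have x4: "x ^ 4 * y \<doteq> y * y"
    unfolding cong_mod_def
    by (rule mem_combination1[OF y2, of _ "- 2 * g ^ 3 + 3 * g ^ 2 - 2 * g + 1"])
      (simp add: x_def y_def eval_nat_numeral algebra_simps)
  \<comment> \<open>Since \<open>x ^ 4\<close> acts on \<open>y\<close> as \<open>y\<close> itself, \<open>x\<^sup>2 z\<close> is \<open>y ^ L\<close>.\<close>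
  define z where "z = y ^ Suc L' * x ^ 2"
  have "z \<in> square_zero"
  proof (rule square_zeroI)
    show "2 * z \<in> I"
      by (rule mem_combination1[OF y2, of _ "y ^ L' * x ^ 2"]) (simp add: z_def ac_simps)
    have "z * z = y ^ Suc (L' + L') * (x ^ 4 * y)"
      by (simp add: z_def eval_nat_numeral power_add ac_simps)
    also have "\<dots> \<doteq> y ^ Suc (L' + L') * (y * y)" by (rule cong_mult_left[OF x4])
    also have "\<dots> = y ^ L' * (y * y ^ L)" by (simp add: L' power_add ac_simps)
    finally show "z * z \<in> I" using mult_mem[OF y_kills[OF yL_sz]] cong_mem_iff by blast
  qed
  then have "g * z \<doteq> z" using g_unit square_zero_unit_mult by blast
  then have "x * z \<in> I" by (simp add: cong_mod_def x_def algebra_simps)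
  then have "x ^ 2 * z \<in> I" using mult_mem by (auto simp: power2_eq_square mult.assoc)
  moreover have "x ^ 2 * z = y ^ L' * (x ^ 4 * y)" by (simp add: z_def eval_nat_numeral ac_simps)
  moreover have "y ^ L' * (x ^ 4 * y) \<doteq> y ^ L' * (y * y)" by (rule cong_mult_left[OF x4])
  moreover have "y ^ L' * (y * y) = y ^ L" by (simp add: L' ac_simps)
  ultimately show False using yL cong_mem_iff by metis
qed

end

section \<open>A unit of infinite order in the cyclotomic integers\<close>

lemma map_poly_of_int_add:
  "map_poly of_int (p + q) = (map_poly of_int p + map_poly of_int q :: 'a::comm_ring_1 poly)"
  by (rule poly_eqI) (simp add: coeff_map_poly)

lemma map_poly_of_int_mult:
  "map_poly of_int (p * q) = (map_poly of_int p * map_poly of_int q :: 'a::comm_ring_1 poly)"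
  by (rule poly_eqI) (simp add: coeff_map_poly coeff_mult)

lemma map_poly_of_int_diff:
  "map_poly of_int (p - q) = (map_poly of_int p - map_poly of_int q :: 'a::comm_ring_1 poly)"
  by (rule poly_eqI) (simp add: coeff_map_poly)

lemma map_poly_of_int_power:
  "map_poly of_int (p ^ k) = (map_poly of_int p :: 'a::comm_ring_1 poly) ^ k"
  by (induction k) (simp_all add: map_poly_of_int_mult)

lemma map_poly_of_rat_mult:
  "map_poly of_rat (p * q) = (map_poly of_rat p * map_poly of_rat q :: 'a::field_char_0 poly)"
  by (rule poly_eqI) (simp add: coeff_map_poly coeff_mult of_rat_sum of_rat_mult)

lemma clear_denominators:
  fixes p :: "rat poly"
  shows "\<exists>N q. N > 0 \<and> smult (of_nat N) p = map_poly of_int q"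
proof (induction p)
  case 0
  then show ?case by (intro exI[of _ 1] exI[of _ 0]) simp
next
  case (pCons a p)
  then obtain N q where N: "N > 0" "smult (of_nat N) p = map_poly of_int q" by blast
  obtain r s where a: "quotient_of a = (r, s)" by fastforce
  then have s: "s > 0" "a = of_int r / of_int s"
    using quotient_of_denom_pos quotient_of_div by auto
  have sn: "(of_nat (nat s) :: rat) = of_int s" using s by (simp add: of_nat_nat)
  have "smult (of_nat (N * nat s)) (pCons a p)
      = pCons (of_nat N * (of_int s * a)) (smult (of_int s) (smult (of_nat N) p))"
    by (simp add: sn ac_simps)
  also have "\<dots> = map_poly of_int (pCons (int N * r) (smult s q))"
    unfolding N(2) using s by (simp add: map_poly_pCons map_poly_smult)
  finally show ?case using N(1) s(1) by (intro exI[of _ "N * nat s"] exI conjI) auto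
qed

text \<open>
  A common factor over the rationals would have a complex root, so \<open>p\<close> and \<open>q\<close> are coprime over the
  rationals. Bezout's identity holds there, and clearing its denominators gives the integer \<open>M\<close>.
\<close>
lemma integer_combination_of_coprime_polys:
  fixes p q :: "int poly"
  assumes no_root: "\<And>z :: complex. \<not> (poly (map_poly of_int p) z = 0 \<and> poly (map_poly of_int q) z = 0)"
  shows "\<exists>M a b. M > 0 \<and> of_nat M = a * p + b * q"
proof -
  define P Q :: "rat poly" where "P = map_poly of_int p" and "Q = map_poly of_int q"
  define D where "D = gcd P Q"
  have to_complex: "map_poly of_int r = (map_poly of_rat (map_poly of_int r) :: complex poly)" for r
    by (rule poly_eqI) (simp add: coeff_map_poly)
  have "degree D = 0"
  proof (rule ccontr)
    assume deg: "degree D \<noteq> 0"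
    have "degree (map_poly of_rat D :: complex poly) = degree D"
      using deg by (intro map_poly_degree_eq) auto
    then have "\<not> constant (poly (map_poly of_rat D :: complex poly))"
      using deg by (simp add: constant_degree)
    then obtain z :: complex where z: "poly (map_poly of_rat D) z = 0"
      using fundamental_theorem_of_algebra by blast
    obtain P' Q' where "P = D * P'" "Q = D * Q'"
      unfolding D_def by (meson dvdE gcd_dvd1 gcd_dvd2)
    then have "poly (map_poly of_int p) z = 0 \<and> poly (map_poly of_int q) z = 0"
      using z by (simp add: to_complex P_def[symmetric] Q_def[symmetric] map_poly_of_rat_mult)
    then show False using no_root by blast
  qed
  moreover have "D \<noteq> 0"
  proof
    assume "D = 0"
    then have "P = 0" "Q = 0" by (simp_all add: D_def)
    then show False 
      using no_root[of 0]
      unfolding to_complex P_def[symmetric] Q_def[symmetric] by simp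
  qed
  ultimately have "D = 1"
    unfolding D_def by (metis coprime_iff_gcd_eq_1 is_unit_gcd is_unit_iff_degree)
  then obtain A B where AB: "A * P + B * Q = 1"
    unfolding D_def by (metis bezout_coefficients_fst_snd)
  obtain N1 a where a: "N1 > 0" "smult (of_nat N1) A = map_poly of_int a" using clear_denominators by blast
  obtain N2 b where b: "N2 > 0" "smult (of_nat N2) B = map_poly of_int b" using clear_denominators by blast
  have "map_poly of_int (of_nat (N1 * N2)) = (of_nat (N1 * N2) :: rat poly)"
    by (simp add: of_nat_poly map_poly_pCons)
  also have "\<dots> = of_nat (N1 * N2) * (A * P + B * Q)" using AB by simp
  also have "\<dots> = of_nat N2 * smult (of_nat N1) A * P + of_nat N1 * smult (of_nat N2) B * Q"
    by (simp add: of_nat_poly algebra_simps smult_add_right)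
  also have "\<dots> = map_poly of_int (of_nat N2 * a * p + of_nat N1 * b * q)"
    unfolding a b P_def Q_def
    by (simp add: map_poly_of_int_add map_poly_of_int_mult of_nat_poly map_poly_smult)
  finally have "of_nat (N1 * N2) = of_nat N2 * a * p + of_nat N1 * b * q"
    by (metis (no_types, lifting) poly_eqI coeff_map_poly of_int_0 of_int_eq_iff)
  then show ?thesis using a(1) b(1) by (intro exI[of _ "N1 * N2"]) auto
qed

text \<open>
  On the unit circle, \<open>1 + z + z\<^sup>2\<close> is \<open>z\<close> times the real number \<open>1 + 2 Re z\<close>, which is \<open>\<plusminus> 1\<close> only at
  the three points \<open>\<plusminus> i\<close> and \<open>-1\<close>.
\<close>
lemma fourth_root_of_unity_if_norm_one_plus_sum:
  fixes z :: complex
  assumes "norm z = 1" and "norm (1 + z + z\<^sup>2) = 1"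
  shows "z ^ 4 = 1"
proof -
  have zc: "z * cnj z = 1" using assms(1) by (simp add: complex_norm_square[symmetric])
  have "1 + z + z\<^sup>2 = z * (cnj z + 1 + z)"
    using zc by (simp add: algebra_simps power2_eq_square)
  also have "cnj z + 1 + z = of_real (1 + 2 * Re z)"
    by (simp add: complex_eq_iff)
  finally have "\<bar>1 + 2 * Re z\<bar> = 1"
    using assms by (simp add: norm_mult del: of_real_add)
  then have "Re z = 0 \<or> Re z = -1" by linarith
  moreover have "(Re z)\<^sup>2 + (Im z)\<^sup>2 = 1"
    using assms(1) by (simp add: cmod_def)
  ultimately have "z = 1 \<or> z = -1 \<or> z = \<i> \<or> z = - \<i>"
    by (auto simp: complex_eq_iff power2_eq_1_iff)
  then show ?thesis by (auto simp: power4_eq_xxxx)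
qed

text \<open>
  If \<open>\<zeta>\<close> is a primitive root of unity of order \<open>2 ^ r \<ge> 8\<close>, then \<open>1 + \<zeta> + \<zeta>\<^sup>2\<close> does not lie on the unit
  circle, so no positive power of it is 1. Hence the two polynomials in \<open>x\<close> below have no common complex
  root: imposing both relations on a ring element leaves a ring of positive characteristic.
\<close>
lemma cyclotomic_unit_infinite_order:
  fixes x :: "'a::comm_ring_1"
  assumes "3 \<le> r" "0 < L"
  shows "\<exists>M a b. M > 0 \<and> of_nat M = a * (x ^ 2 ^ (r - 1) + 1) + b * ((1 + x + x\<^sup>2) ^ L - 1)"
proof -
  define p :: "int poly" where "p = [:0, 1:] ^ 2 ^ (r - 1) + 1"
  define q :: "int poly" where "q = [:1, 1, 1:] ^ L - 1"
  have p: "poly (map_poly of_int p) y = y ^ 2 ^ (r - 1) + 1" for y :: "'b::comm_ring_1"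
    by (simp add: p_def map_poly_of_int_add map_poly_of_int_power map_poly_pCons)
  have q: "poly (map_poly of_int q) y = (1 + y + y\<^sup>2) ^ L - 1" for y :: "'b::comm_ring_1"
    by (simp add: q_def map_poly_of_int_diff map_poly_of_int_power map_poly_pCons
        algebra_simps power2_eq_square)
  have "\<not> (poly (map_poly of_int p) z = 0 \<and> poly (map_poly of_int q) z = 0)" for z :: complex
  proof (rule notI, elim conjE)
    assume "poly (map_poly of_int p) z = 0" "poly (map_poly of_int q) z = 0"
    then have z: "z ^ 2 ^ (r - 1) = -1" "(1 + z + z\<^sup>2) ^ L = 1"
      unfolding p q by (simp_all add: add_eq_0_iff2)
    have "norm z ^ 2 ^ (r - 1) = 1" using z(1) by (metis norm_minus_cancel norm_one norm_power)
    then have "norm z = 1" using power_eq_imp_eq_base[of "norm z" "2 ^ (r - 1)" 1] by simp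
    moreover have "norm (1 + z + z\<^sup>2) ^ L = 1" using z(2) by (metis norm_one norm_power)
    then have "norm (1 + z + z\<^sup>2) = 1" 
      using power_eq_imp_eq_base[of "norm (1 + z + z\<^sup>2)" L 1] assms(2) by simp
    ultimately have "z ^ 4 = 1" by (rule fourth_root_of_unity_if_norm_one_plus_sum)
    moreover have "(2::nat) ^ (r - 1) = 4 * 2 ^ (r - 3)"

    proof -
      have "r - 1 = 2 + (r - 3)" using assms(1) by simp
      then have "(2::nat) ^ (r - 1) = 2\<^sup>2 * 2 ^ (r - 3)" by (metis power_add)
      then show ?thesis by simp
    qed
    ultimately have "z ^ 2 ^ (r - 1) = 1" by (simp add: power_mult)
    with z(1) show False by simp
  qed
  then obtain M a b where "M > 0" and "of_nat M = a * p + b * q"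
    using integer_combination_of_coprime_polys by blast
  then have "poly (map_poly of_int (of_nat M)) x
      = poly (map_poly of_int a) x * (x ^ 2 ^ (r - 1) + 1) + poly (map_poly of_int b) x * ((1 + x + x\<^sup>2) ^ L - 1)"
    by (simp add: map_poly_of_int_add map_poly_of_int_mult p q)
  moreover have "poly (map_poly of_int (of_nat M)) x = of_nat M"
    by (simp add: of_nat_poly map_poly_pCons)
  ultimately show ?thesis using \<open>M > 0\<close> by metis
qed

section \<open>The part on which a power of g acts as minus one\<close>

text \<open>
  Modulo 2 and \<open>x ^ 2 ^ s + 1\<close>, Frobenius turns \<open>1 + x + x\<^sup>2\<close> into \<open>1 + x ^ 2 ^ s + x ^ (2 * 2 ^ s)\<close>,
  which is 1; each further squaring improves the congruence by a factor 2.
\<close>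
lemma one_plus_sum_power_two_power:
  fixes x :: "'a::comm_ring_1"
  assumes "0 < k"
  shows "\<exists>c d. (1 + x + x\<^sup>2) ^ (2 ^ s * 2 ^ (k - 1)) = 1 + 2 ^ k * c + (x ^ 2 ^ s + 1) * d"
  using assms
proof (induction k rule: nat_induct_non_zero)
  case 1
  obtain c1 where c1: "(1 + (x + x\<^sup>2)) ^ 2 ^ s = 1 + (x + x\<^sup>2) ^ 2 ^ s + 2 * (x + x\<^sup>2) * c1"
    using power_two_freshman by blast
  obtain c2 where c2: "(1 + x) ^ 2 ^ s = 1 + x ^ 2 ^ s + 2 * x * c2"
    using power_two_freshman by blast
  have "(x + x\<^sup>2) ^ 2 ^ s = x ^ 2 ^ s * (1 + x) ^ 2 ^ s"
    by (simp add: power2_eq_square algebra_simps flip: power_mult_distrib)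
  then have "(1 + x + x\<^sup>2) ^ (2 ^ s * 2 ^ (1 - 1))
      = 1 + 2 ^ 1 * (x ^ 2 ^ s * x * c2 + (x + x\<^sup>2) * c1) + (x ^ 2 ^ s + 1) * x ^ 2 ^ s"
    using c1 c2 by (simp add: algebra_simps)
  then show ?case by blast
next
  case (Suc k)
  then obtain c d where cd:
    "(1 + x + x\<^sup>2) ^ (2 ^ s * 2 ^ (k - 1)) = 1 + 2 ^ k * c + (x ^ 2 ^ s + 1) * d" by blast
  have exponent: "2 ^ s * 2 ^ (Suc k - 1) = 2 ^ s * 2 ^ (k - 1) * (2::nat)"
    using \<open>0 < k\<close> by (cases k) auto
  obtain k' where k': "k = Suc k'" using \<open>0 < k\<close> by (cases k) auto
  have "(1 + x + x\<^sup>2) ^ (2 ^ s * 2 ^ (Suc k - 1)) = (1 + 2 ^ k * c + (x ^ 2 ^ s + 1) * d)\<^sup>2"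
    by (simp only: exponent power_mult[of _ _ 2] cd)
  also have "\<dots> = 1 + 2 ^ Suc k * (c + 2 ^ k' * c * c)
      + (x ^ 2 ^ s + 1) * (2 * (1 + 2 ^ k * c) * d + (x ^ 2 ^ s + 1) * d * d)"
    by (simp add: k' power2_eq_square algebra_simps)
  finally show ?case by blast
qed

text \<open>
  Multiplication by \<open>1 + x + x\<^sup>2\<close> turns the sum of \<open>x ^ (3 i)\<close> over \<open>i < l\<close> into the sum of \<open>x ^ i\<close> over
  \<open>i < 3 l\<close>. If \<open>3 l = 2 ^ m + 1\<close> with \<open>m > s\<close>, this is 1 plus \<open>x\<close> times the sum over \<open>i < 2 ^ m\<close>, and
  \<open>x ^ 2 ^ s + 1\<close> divides the latter. Such an \<open>l\<close> exists for every odd \<open>m\<close>, for example \<open>m = 2 s + 1\<close>.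
\<close>
lemma one_plus_sum_inverse:
  fixes x :: "'a::comm_ring_1"
  shows "\<exists>v d. (1 + x + x\<^sup>2) * v = 1 + (x ^ 2 ^ s + 1) * d"
proof -
  have sum_triples: "(1 + x + x\<^sup>2) * (\<Sum>i<l. x ^ (3 * i)) = (\<Sum>i<3 * l. x ^ i)" for l
    by (induction l) (simp_all add: algebra_simps eval_nat_numeral)
  have split_sum: "(\<Sum>i<a + b. x ^ i) = (\<Sum>i<a. x ^ i) + x ^ a * (\<Sum>i<b. x ^ i)" for a b
    by (induction b) (simp_all add: algebra_simps power_add)
  have factor: "\<exists>d. (\<Sum>i<2 ^ Suc (s + k). x ^ i) = (x ^ 2 ^ s + 1) * d" for k
  proof (induction k)
    case 0
    show ?case
      using split_sum[of "2 ^ s" "2 ^ s"]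
      by (intro exI[of _ "\<Sum>i<2 ^ s. x ^ i"]) (simp add: mult_2 algebra_simps)
  next
    case (Suc k)
    then obtain d where d: "(\<Sum>i<2 ^ Suc (s + k). x ^ i) = (x ^ 2 ^ s + 1) * d" by blast
    define m :: nat where "m = 2 ^ Suc (s + k)"
    have "2 ^ Suc (s + Suc k) = m + m" by (simp add: m_def)
    moreover have "(\<Sum>i<m + m. x ^ i) = (x ^ 2 ^ s + 1) * (d + x ^ m * d)"
      using split_sum[of m m] d unfolding m_def[symmetric] by (simp add: algebra_simps)
    ultimately show ?case by metis
  qed
  obtain k l where kl: "3 * l = 2 ^ Suc (s + k) + (1::nat)"
  proof -
    have "3 dvd 2 ^ Suc (2 * i) + (1::nat)" for i
    proof (induction i)
      case (Suc i)
      then obtain l where "2 ^ Suc (2 * i) + (1::nat) = 3 * l" by blast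
      then have "2 ^ Suc (2 * Suc i) + (1::nat) = 3 * (4 * l - 1)" by simp
      then show ?case by (metis dvd_triv_left)
    qed simp
    from this[of s] obtain l where "2 ^ Suc (2 * s) + (1::nat) = 3 * l" by blast
    then show ?thesis using that[of l s] by (simp flip: mult_2)
  qed
  obtain d where d: "(\<Sum>i<2 ^ Suc (s + k). x ^ i) = (x ^ 2 ^ s + 1) * d" using factor by blast
  have "(1 + x + x\<^sup>2) * (\<Sum>i<l. x ^ (3 * i)) = (\<Sum>i<Suc (2 ^ Suc (s + k)). x ^ i)"
    unfolding sum_triples kl by simp
  also have "\<dots> = 1 + x * ((x ^ 2 ^ s + 1) * d)"
    unfolding d[symmetric] sum.lessThan_Suc_shift by (simp add: sum_distrib_left)
  finally show ?thesis by (intro exI[of _ "\<Sum>i<l. x ^ (3 * i)"] exI[of _ "x * d"]) (simp add: ac_simps)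
qed

context monomial_units
begin

text \<open>
  The hypotheses say that \<open>g ^ 2 ^ (r - 1)\<close> acts on \<open>t\<close> as \<open>-1\<close> and \<open>t\<close> itself as \<open>- 2 ^ k\<close>. Hence an
  element of the form \<open>1 - t c\<close> acts on \<open>t\<close> as \<open>1 + 2 ^ k c\<close>, and for suitable \<open>N\<close> and \<open>c\<close> this is the
  power \<open>v ^ N\<close> of the cyclotomic unit \<open>v = 1 + g + g\<^sup>2\<close>. As a unit, \<open>1 - t c\<close> has finite order, so a
  power of \<open>v\<close> acts on \<open>t\<close> as 1.
\<close>
lemma eigen_part_torsion:
  assumes "3 \<le> r" and "0 < k"
    and eigen: "t * (g ^ 2 ^ (r - 1) + 1) \<in> I" and quad: "t * t + 2 ^ k * t \<in> I"
  shows "\<exists>M > 0. of_nat M * t \<in> I"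
proof -
  define v where "v = 1 + g + g\<^sup>2"
  define N :: nat where "N = 2 ^ (r - 1) * 2 ^ (k - 1)"
  obtain c d where cd: "v ^ N = 1 + 2 ^ k * c + (g ^ 2 ^ (r - 1) + 1) * d"
    unfolding v_def N_def using one_plus_sum_power_two_power[OF assms(2)] by blast
  obtain v' d' where v': "v * v' = 1 + (g ^ 2 ^ (r - 1) + 1) * d'"
    unfolding v_def using one_plus_sum_inverse by blast
  have "t * (v * v') \<doteq> t * 1" unfolding cong_mod_def v'
    by (rule mem_combination1[OF eigen, of _ d']) (simp add: algebra_simps)
  then have "t * (v * v') ^ N \<doteq> t * 1 ^ N" by (rule cong_absorb_power)
  then have tvv: "t * (v ^ N * v' ^ N) \<doteq> t" by (simp add: power_mult_distrib)
  define w where "w = 1 - t * c"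
  have tw: "t * w \<doteq> t * v ^ N" unfolding cong_mod_def
    by (rule mem_combination2[OF quad eigen, of _ "- c" "- d"]) (simp add: w_def cd algebra_simps)
  \<comment> \<open>The inverse of \<open>w\<close> is obtained from that of \<open>v\<close>, without a division by \<open>2 ^ k\<close>.\<close>
  have "w * (1 + t * c * v' ^ N) = w + (t * w) * (c * v' ^ N)" by (simp add: algebra_simps)
  also have "\<dots> \<doteq> w + (t * v ^ N) * (c * v' ^ N)" by (intro cong_add cong_mult_right tw) simp
  also have "\<dots> = w + c * (t * (v ^ N * v' ^ N))" by (simp add: algebra_simps)
  also have "\<dots> \<doteq> w + c * t" by (intro cong_add cong_mult_left tvv) simp
  also have "\<dots> = 1" by (simp add: w_def)
  finally have wn: "w ^ 2 ^ u \<doteq> 1" by (rule unit_power)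
  have "t * (v ^ N) ^ 2 ^ u \<doteq> t * w ^ 2 ^ u" by (intro cong_absorb_power cong_sym[OF tw])
  also have "\<dots> \<doteq> t * 1" by (rule cong_mult_left[OF wn])
  finally have tv: "t * (v ^ (N * 2 ^ u) - 1) \<in> I"
    by (simp add: cong_mod_def algebra_simps flip: power_mult)
  have "0 < N * 2 ^ u" by (simp add: N_def)
  then obtain M a b where M: "M > 0"
    "of_nat M = a * (g ^ 2 ^ (r - 1) + 1) + b * (v ^ (N * 2 ^ u) - 1)"
    unfolding v_def using cyclotomic_unit_infinite_order[OF assms(1)] by blast
  have "of_nat M * t \<in> I"
    by (rule mem_combination2[OF eigen tv, of _ a b]) (simp add: M(2) algebra_simps)
  then show ?thesis using M(1) by blast
qed

text \<open>
  Let \<open>s\<close> be a multiple of \<open>t\<close> of additive order \<open>p\<close>, an odd prime. Then \<open>s\<^sup>2\<close> is an integer multiple of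
  \<open>s\<close>. If that integer is invertible modulo \<open>p\<close>, a multiple of \<open>s\<close> is idempotent. Otherwise \<open>s\<^sup>2 = 0\<close>,
  and \<open>1 + s\<close> would be a unit of order \<open>p\<close>, but the orders of units are powers of 2.
\<close>
lemma odd_torsion_idempotent:
  assumes quad: "t * t + 2 ^ k * t \<in> I" and torsion: "of_nat M * t \<in> I" "M > 0"
    and not_two: "\<And>j. 2 ^ j * t \<notin> I"
  obtains p c where "Factorial_Ring.prime p" "odd p" "c * t * (c * t) \<doteq> c * t" "of_nat p * (c * t) \<in> I" "c * t \<notin> I"
proof -
  define m where "m = (LEAST m. m > 0 \<and> of_nat m * t \<in> I)"
  have m: "m > 0" "of_nat m * t \<in> I"
    using LeastI[of "\<lambda>m. m > 0 \<and> of_nat m * t \<in> I" M] torsion by (auto simp: m_def)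
  have below: "of_nat j * t \<notin> I" if "0 < j" "j < m" for j
    using that not_less_Least[of j "\<lambda>m. m > 0 \<and> of_nat m * t \<in> I"] by (auto simp: m_def)
  have "\<exists>p. Factorial_Ring.prime p \<and> odd p \<and> p dvd m"
  proof (rule ccontr)
    assume "\<nexists>p. Factorial_Ring.prime p \<and> odd p \<and> p dvd m"
    moreover obtain j q where jq: "m = 2 ^ j * q" "odd q"
      by (rule multiplicity_decompose'[of m 2]) (use m(1) in auto)
    moreover have "\<exists>p. Factorial_Ring.prime p \<and> p dvd q" if "q \<noteq> 1" using prime_factor_nat that by blast
    ultimately have "q = 1" by (metis dvd_mult dvd_trans)
    then show False using m(2) not_two[of j] jq(1) by simp
  qed
  then obtain p b where p: "Factorial_Ring.prime p" "odd p" "m = p * b" by blast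
  define s where "s = of_nat b * t"
  have b: "b > 0" "b < m" using m(1) p prime_gt_1_nat[OF p(1)] by auto
  have s: "s \<notin> I" unfolding s_def using below b by blast
  have ps: "of_nat p * s \<in> I" using m(2) by (simp add: s_def p(3) mult.assoc)
  have ss: "s * s + of_nat (b * 2 ^ k) * s \<in> I"
    by (rule mem_combination1[OF quad, of _ "of_nat b * of_nat b"]) (simp add: s_def algebra_simps)
  have ps': "of_int (int p) * s \<in> I" using ps by simp
  have "coprime (int p) (int (b * 2 ^ k))"
  proof (rule ccontr)
    assume "\<not> coprime (int p) (int (b * 2 ^ k))"
    then have "p dvd b * 2 ^ k"
      using p(1) prime_imp_coprime_nat[of p "b * 2 ^ k"] by (auto simp del: int_ops)
    then obtain b' where b': "b * 2 ^ k = p * b'" by blast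
    have sq: "s * s \<in> I"
      by (rule mem_combination2[OF ss ps, of _ 1 "- of_nat b'"]) (simp add: b' algebra_simps)
    have "(1 + s) * (1 - s) \<doteq> 1" unfolding cong_mod_def
      by (rule mem_combination1[OF sq, of _ "-1"]) (simp add: algebra_simps)
    then have unit: "(1 + s) ^ 2 ^ u \<doteq> 1" by (rule unit_power)
    have "(1 + s) ^ j \<doteq> 1 + of_nat j * s" for j
    proof (induction j)
      case (Suc j)
      have "(1 + s) ^ Suc j \<doteq> (1 + s) * (1 + of_nat j * s)" using cong_mult_left[OF Suc] by simp
      also have "\<dots> \<doteq> 1 + of_nat (Suc j) * s" unfolding cong_mod_def
        by (rule mem_combination1[OF sq, of _ "of_nat j"]) (simp add: algebra_simps)
      finally show ?case .
    qed simp
    then have "1 + of_nat (2 ^ u) * s \<doteq> 1" using unit cong_sym cong_trans by blast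
    then have "of_int (2 ^ u) * s \<in> I" by (simp add: cong_mod_def)
    then have "s \<in> I" by (rule coprime_multiples_mem[OF ps']) (use p in \<open>simp add: coprime_commute\<close>)
    with s show False ..
  qed
  then obtain x y where xy: "x * int p + y * int (b * 2 ^ k) = 1"
    by (metis bezout_int coprime_imp_gcd_eq_1)
  define e where "e = of_int (- y) * s"
  have y: "of_int y * of_nat (b * 2 ^ k) = (1 - of_int x * of_nat p :: 'p)"
    using arg_cong[OF xy, of "of_int :: int \<Rightarrow> 'p"] by (simp add: algebra_simps eq_diff_eq)
  have "e * e - e = of_int y * of_int y * (s * s + of_nat (b * 2 ^ k) * s)
      - of_int y * (of_int y * of_nat (b * 2 ^ k)) * s + of_int y * s"
    by (simp add: e_def algebra_simps)
  also have "\<dots> = of_int y * of_int y * (s * s + of_nat (b * 2 ^ k) * s) + of_int y * of_int x * (of_nat p * s)"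
    unfolding y by (simp add: algebra_simps)
  finally have "e * e \<doteq> e" unfolding cong_mod_def by (rule mem_combination2[OF ss ps])
  moreover have "of_nat p * e \<in> I"
    by (rule mem_combination1[OF ps, of _ "of_int (- y)"]) (simp add: e_def algebra_simps)
  moreover have "e \<notin> I"
  proof
    assume "e \<in> I"
    then have "of_int y * s \<in> I" using uminus_mem[of e] by (simp add: e_def)
    moreover have "coprime y (int p)" using xy
      by (metis coprimeI dvd_add dvd_mult dvd_mult2 add.commute)
    ultimately show False using coprime_multiples_mem[OF _ ps'] s by blast
  qed
  moreover have "e = of_int (- y) * of_nat b * t" by (simp add: e_def s_def)
  ultimately show ?thesis using that p(1,2) by metis
qed

section \<open>Corner rings of odd characteristic\<close>

text \<open>
  A unit \<open>e x\<close> of the corner ring of an idempotent \<open>e\<close> becomes a unit of the whole ring when \<open>1 - e\<close>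
  is added.
\<close>
lemma corner_unit:
  assumes idem: "e * e \<doteq> e" and unit: "e * (x * y) \<doteq> e"
  shows "(1 - e + e * x) * (1 - e + e * y) \<doteq> 1"
proof -
  have i: "e * e - e \<in> I" and un: "e * (x * y) - e \<in> I" using assms by (simp_all add: cong_mod_def)
  show ?thesis unfolding cong_mod_def
    by (rule mem_combination2[OF i un, of _ "1 - x - y + x * y" 1]) (simp add: algebra_simps)
qed

lemma corner_power:
  assumes idem: "e * e \<doteq> e"
  shows "(1 - e + e * x) ^ k \<doteq> 1 - e + e * x ^ k"
proof (induction k)
  case (Suc k)
  have i: "e * e - e \<in> I" using assms by (simp add: cong_mod_def)
  have "(1 - e + e * x) ^ Suc k \<doteq> (1 - e + e * x) * (1 - e + e * x ^ k)"
    using cong_mult_left[OF Suc] by simp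
  also have "\<dots> \<doteq> 1 - e + e * x ^ Suc k" unfolding cong_mod_def
    by (rule mem_combination1[OF i, of _ "1 - x - x ^ k + x * x ^ k"]) (simp add: algebra_simps)
  finally show ?case .
qed simp

lemma corner_unit_power:
  assumes idem: "e * e \<doteq> e" and unit: "e * (x * y) \<doteq> e"
  shows "e * x ^ 2 ^ u \<doteq> e"
proof -
  have "(1 - e + e * x) ^ 2 ^ u \<doteq> 1" using corner_unit[OF assms] by (rule unit_power)
  then have "1 - e + e * x ^ 2 ^ u \<doteq> 1" using corner_power[OF idem] cong_sym cong_trans by blast
  then show ?thesis by (simp add: cong_mod_def algebra_simps)
qed

lemma corner_power_gcd:
  assumes "e * x ^ a \<doteq> e" "e * x ^ b \<doteq> e" "a \<noteq> 0"
  shows "e * x ^ gcd a b \<doteq> e"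
proof -
  obtain k l where kl: "a * k = b * l + gcd a b" using bezout_nat[OF assms(3)] by blast
  have a: "e * x ^ (a * k) \<doteq> e" using cong_absorb_power[of e "x ^ a" 1 k] assms(1) by (simp add: power_mult)
  have b: "e * x ^ (b * l) \<doteq> e" using cong_absorb_power[of e "x ^ b" 1 l] assms(2) by (simp add: power_mult)
  have "e * x ^ gcd a b \<doteq> (e * x ^ (b * l)) * x ^ gcd a b"
    by (intro cong_mult_right cong_sym[OF b])
  also have "\<dots> = e * x ^ (a * k)" by (simp add: kl power_add ac_simps)
  also have "\<dots> \<doteq> e" by (rule a)
  finally show ?thesis .
qed

lemma odd_multiple_mem:
  assumes "of_nat p * x \<in> I" "2 ^ k * x \<in> I" "odd p"
  shows "x \<in> I"
proof (rule coprime_multiples_mem)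
  show "of_int (int p) * x \<in> I" "of_int (2 ^ k) * x \<in> I" using assms by simp_all
  show "coprime (int p) (2 ^ k)" using assms(3) by (simp add: coprime_commute)
qed

text \<open>
  The unit \<open>1 - e + e g\<close> has a power that is the fourth power of a unit and equals \<open>1 - 2 e\<close>. This
  is an involution, so it is \<open>g ^ 2 ^ (u - 1)\<close>, which therefore acts on \<open>e\<close> as \<open>-1\<close>. If \<open>r < u\<close>, it acts
  as 1.
\<close>
lemma corner_top_level:
  assumes r: "3 \<le> r" "r \<le> u"
    and idem: "e * e \<doteq> e" and p: "odd p" "of_nat p * e \<in> I" and e: "e \<notin> I"
    and eigen: "e * (g ^ 2 ^ (r - 1) + 1) \<in> I"
  shows "r = u"
proof (rule ccontr)
  assume "r \<noteq> u"
  define y where "y = (1 - e + e * g) ^ 2 ^ (r - 3)"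
  have exps: "(2::nat) ^ (r - 1) = 2 ^ (r - 3) * 4" "(2::nat) ^ r = 2 ^ (r - 3) * 8"
    "(2::nat) ^ r = 2 ^ (r - 1) * 2"
  proof -
    obtain r' where r': "r = 3 + r'" using r(1) le_Suc_ex by blast
    have "3 + r' - 1 = Suc (Suc r')" by simp
    then show "(2::nat) ^ (r - 1) = 2 ^ (r - 3) * 4" "(2::nat) ^ r = 2 ^ (r - 3) * 8"
      "(2::nat) ^ r = 2 ^ (r - 1) * 2"
      unfolding r' by (simp_all add: power_add)
  qed
  have half: "e * g ^ 2 ^ (r - 1) \<doteq> e * - 1"
    using eigen by (simp add: cong_mod_def algebra_simps)
  have full: "e * g ^ 2 ^ r \<doteq> e"
    using cong_absorb_power[OF half, of 2] unfolding exps(3) by (simp add: power_mult)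
  have ypow: "y ^ k \<doteq> 1 - e + e * g ^ (2 ^ (r - 3) * k)" for k
    unfolding y_def power_mult[symmetric] by (rule corner_power[OF idem])
  have y4: "y ^ 4 \<doteq> 1 - 2 * e"
  proof -
    have "y ^ 4 \<doteq> 1 - e + e * g ^ 2 ^ (r - 1)" using ypow[of 4] by (simp only: exps(1))
    also have "\<dots> \<doteq> 1 - e + e * - 1" by (intro cong_add half) simp
    finally show ?thesis by simp
  qed
  have y8: "y ^ 8 \<doteq> 1"
  proof -
    have "y ^ 8 \<doteq> 1 - e + e * g ^ 2 ^ r" using ypow[of 8] by (simp only: exps(2))
    also have "\<dots> \<doteq> 1 - e + e" by (intro cong_add full) simp
    finally show ?thesis by simp
  qed
  have e2: "2 * e \<notin> I" using odd_multiple_mem[OF p(2), of 1] p(1) e by auto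
  have "\<not> y ^ 4 \<doteq> 1"
  proof
    assume "y ^ 4 \<doteq> 1"
    then have "1 \<doteq> 1 - 2 * e" using y4 cong_sym cong_trans by blast
    then show False using e2 by (simp add: cong_mod_def)
  qed
  then have "y ^ 4 \<doteq> g ^ 2 ^ (u - 1)" using y8 fourth_power_involution by blast
  then have "1 - 2 * e \<doteq> g ^ 2 ^ (u - 1)" using y4 cong_sym cong_trans by blast
  then have "e * (1 - 2 * e) \<doteq> e * g ^ 2 ^ (u - 1)" by (rule cong_mult_left)
  also have "\<dots> = e * (g ^ 2 ^ r) ^ 2 ^ (u - 1 - r)"
  proof -
    have "u - 1 = r + (u - 1 - r)" using \<open>r \<noteq> u\<close> r by simp
    then show ?thesis by (metis power_add power_mult)
  qed
  also have "\<dots> \<doteq> e * 1 ^ 2 ^ (u - 1 - r)" using full by (intro cong_absorb_power) simp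
  finally have "e * (1 - 2 * e) - e \<in> I" by (simp add: cong_mod_def)
  moreover have "e * e - e \<in> I" using idem by (simp add: cong_mod_def)
  ultimately have "2 * e \<in> I"
    by (rule mem_combination2[of _ _ _ "-1" "-2"]) (simp add: algebra_simps)
  with e2 show False ..
qed

text \<open>
  The corner ring contains the prime field, whose unit group is cyclic of order \<open>p - 1\<close>; the
  exponent of the units of the corner ring divides \<open>2 ^ u\<close>.
\<close>
lemma corner_characteristic:
  assumes idem: "e * e \<doteq> e" and p: "Factorial_Ring.prime p" "odd p" "of_nat p * e \<in> I" and e: "e \<notin> I"
  obtains v where "0 < v" "v \<le> u" "p = 2 ^ v + 1"
proof -
  obtain a where a: "residue_primroot p a"
    using prime_primitive_root_exists[OF prime_gt_1_nat[OF p(1)] p(1)] by blast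
  then have ord: "ord p a = p - 1" and cop: "coprime p a"
    by (auto simp: residue_primroot_def totient_prime[OF p(1)])
  obtain b where b: "[a * b = 1] (mod p)"
    using cop cong_solve_coprime_nat by (metis coprime_commute One_nat_def)
  have lift: "e * of_nat c \<doteq> e * of_nat d" if "[c = d] (mod p)" for c d
  proof -
    have "[int c = int d] (mod int p)" using that by (simp add: cong_int_iff)
    then obtain k where k: "int c - int d = int p * k" by (auto simp: cong_iff_dvd_diff)
    have "(of_nat c - of_nat d :: 'p) = of_nat p * of_int k"
      using arg_cong[OF k, of "of_int :: int \<Rightarrow> 'p"] by simp
    then have "e * of_nat c - e * of_nat d = of_int k * (of_nat p * e)"
      by (simp add: algebra_simps flip: right_diff_distrib)
    then show ?thesis unfolding cong_mod_def by (rule mem_combination1[OF p(3)])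
  qed
  have "e * (of_nat a * of_nat b) \<doteq> e" using lift[OF b] by simp
  then have unit: "e * of_nat a ^ 2 ^ u \<doteq> e" by (rule corner_unit_power[OF idem])
  have "[a ^ 2 ^ u = 1] (mod p)"
  proof (rule ccontr)
    assume "\<not> [a ^ 2 ^ u = 1] (mod p)"
    then have "\<not> int p dvd int (a ^ 2 ^ u) - 1"
      using cong_int_iff[of "a ^ 2 ^ u" 1 p] by (simp add: cong_iff_dvd_diff)
    then have "coprime (int p) (int (a ^ 2 ^ u) - 1)"
      using p(1) by (intro prime_imp_coprime) auto
    moreover have "of_int (int (a ^ 2 ^ u) - 1) * e \<in> I"
      using unit by (simp add: cong_mod_def algebra_simps)
    moreover have "of_int (int p) * e \<in> I" using p(3) by simp
    ultimately show False using coprime_multiples_mem e by blast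
  qed
  then have "p - 1 dvd 2 ^ u" using ord_divides[of a "2 ^ u" p] ord by simp
  then obtain v where v: "v \<le> u" "p - 1 = 2 ^ v"
    using divides_primepow_nat[OF two_is_prime_nat] by blast
  then have "p = 2 ^ v + 1" using prime_gt_1_nat[OF p(1)] by simp
  moreover have "v \<noteq> 0" using calculation p(2) by (intro notI) simp
  ultimately show ?thesis using that v(1) by blast
qed

text \<open>
  Let \<open>q = 2 ^ w + 1\<close> be a power of \<open>p\<close> with \<open>2 \<le> w < u\<close>, and let \<open>x\<close> be the power of \<open>g\<close> with
  \<open>x ^ 2 ^ w = -1\<close> in the corner ring. The Frobenius map of exponent \<open>q\<close> sends \<open>x\<close> to \<open>- x\<close>, so it
  exchanges \<open>1 + x\<close> and \<open>1 - x\<close>. Hence the order of the unit \<open>1 + x\<close> divides \<open>q\<^sup>2 - 1\<close> and \<open>2 ^ u\<close>, whose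
  greatest common divisor is \<open>2 ^ (w + 1) = 2 q - 2\<close>. So \<open>(1 - x)\<^sup>2 = (1 + x) ^ (2 q) = (1 + x)\<^sup>2\<close>,
  that is, \<open>4 x = 0\<close>, which is impossible in odd characteristic.
\<close>
lemma corner_fermat_prime_power_maximal:
  assumes idem: "e * e \<doteq> e" and p: "Factorial_Ring.prime p" "odd p" "of_nat p * e \<in> I" and e: "e \<notin> I"
    and eigen: "e * (g ^ 2 ^ (u - 1) + 1) \<in> I"
    and Q: "p ^ k = 2 ^ w + 1" and w: "2 \<le> w" "w < u"
  shows False
proof -
  define q where "q = p ^ k"
  define x where "x = g ^ 2 ^ (u - 1 - w)"
  have "g ^ 2 ^ (u - 1) = x ^ 2 ^ w"
  proof -
    have "u - 1 = u - 1 - w + w" using w by simp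
    then show ?thesis unfolding x_def by (metis power_add power_mult)
  qed
  then have xw: "e * x ^ 2 ^ w \<doteq> e * - 1" using eigen by (simp add: cong_mod_def algebra_simps)
  have xq: "e * x ^ q \<doteq> e * - x"
    using cong_mult_right[OF xw, of x] by (simp add: q_def Q ac_simps)
  have frobenius: "e * (1 + y) ^ q \<doteq> e * (1 + y ^ q)" for y
  proof -
    obtain c where "(1 + y) ^ q = 1 + y ^ q + of_nat p * c"
      unfolding q_def using power_prime_freshman[OF p(1)] by blast
    then show ?thesis unfolding cong_mod_def
      by (intro mem_combination1[OF p(3), of _ c]) (simp add: algebra_simps)
  qed
  have f1: "e * (1 + x) ^ q \<doteq> e * (1 - x)"
  proof -
    have "e * (1 + x) ^ q \<doteq> e + e * x ^ q" using frobenius[of x] by (simp add: algebra_simps)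
    also have "\<dots> \<doteq> e + e * - x" by (intro cong_add xq) simp
    finally show ?thesis by (simp add: algebra_simps)
  qed
  have odd_q: "odd q" using p(2) by (simp add: q_def)
  have f2: "e * (1 - x) ^ q \<doteq> e * (1 + x)"
  proof -
    have "e * (1 - x) ^ q \<doteq> e - e * x ^ q" using frobenius[of "- x"] odd_q by (simp add: algebra_simps)
    also have "\<dots> \<doteq> e - e * - x" by (intro cong_diff xq) simp
    finally show ?thesis by (simp add: algebra_simps)
  qed
  have f3: "e * (1 + x) ^ (q * q) \<doteq> e * (1 + x)"
    using cong_absorb_power[OF f1, of q] f2 cong_trans by (simp add: power_mult)
  \<comment> \<open>\<open>1 + x\<close> divides \<open>x ^ 2 ^ w - 1\<close>, which is \<open>-2\<close> in the corner ring and hence invertible.\<close>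
  obtain y where y: "e * ((1 + x) * y) \<doteq> e"
  proof -
    obtain w' where w': "w = Suc w'" using w(1) by (cases w) auto
    have "x + 1 dvd x ^ 2 ^ w - 1"
    proof -
      have "x\<^sup>2 - 1 dvd (x\<^sup>2) ^ 2 ^ w' - 1" by (metis dvd_triv_left one_power2 power_one power_diff_sumr2 )
      moreover have "x\<^sup>2 - 1 = (x + 1) * (x - 1)" by (simp add: power2_eq_square algebra_simps)
      ultimately show ?thesis by (metis dvd_mult_left power_Suc power_mult w')
    qed
    then obtain d where d: "x ^ 2 ^ w - 1 = (x + 1) * d" by blast
    obtain h where h: "p + 1 = 2 * h" using p(2) by (metis even_Suc Suc_eq_plus1 evenE)
    have "e * ((1 + x) * (- of_nat h * d)) = - of_nat h * (e * (x ^ 2 ^ w - 1))"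
      unfolding d by (simp add: algebra_simps)
    also have "\<dots> \<doteq> - of_nat h * (e * - 2)"
    proof (rule cong_mult_left)
      have "e * (x ^ 2 ^ w - 1) = e * x ^ 2 ^ w - e" by (simp add: algebra_simps)
      also have "\<dots> \<doteq> e * - 1 - e" by (intro cong_diff xw) simp
      finally show "e * (x ^ 2 ^ w - 1) \<doteq> e * - 2" by (simp add: algebra_simps)
    qed
    also have "\<dots> = of_nat (2 * h) * e" by (simp add: algebra_simps)
    also have "\<dots> \<doteq> e" unfolding h[symmetric] cong_mod_def using p(3) by (simp add: algebra_simps)
    finally show ?thesis using that by blast
  qed
  then have n: "e * (1 + x) ^ 2 ^ u \<doteq> e" by (rule corner_unit_power[OF idem])
  have q1: "q \<ge> 1" using Q by (simp add: q_def)
  have qq: "e * (1 + x) ^ (q * q - 1) \<doteq> e"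
  proof -
    have "e * (1 + x) ^ (q * q - 1) \<doteq> e * ((1 + x) * y) * (1 + x) ^ (q * q - 1)"
      by (intro cong_mult_right cong_sym[OF y])
    also have "\<dots> = e * (1 + x) ^ (q * q) * y"
    proof -
      have "q * q = Suc (q * q - 1)" using q1 by simp
      then have "(1 + x) ^ (q * q) = (1 + x) * (1 + x) ^ (q * q - 1)" by (metis power_Suc)
      then show ?thesis by (simp add: ac_simps)
    qed
    also have "\<dots> \<doteq> e * (1 + x) * y" by (rule cong_mult_right[OF f3])
    also have "\<dots> = e * ((1 + x) * y)" by (simp add: ac_simps)
    finally show ?thesis using y cong_trans by blast
  qed
  have gcd: "gcd (2 ^ u) (q * q - 1) = 2 ^ Suc w"
  proof -
    obtain w' where w': "w = Suc (Suc w')" using w(1) by (metis add_2_eq_Suc le_Suc_ex)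
    have "q * q - 1 = 2 ^ Suc w * (2 * 2 ^ w' + 1)" by (simp add: q_def Q w' algebra_simps)
    moreover have "(2::nat) ^ u = 2 ^ Suc w * 2 ^ (u - Suc w)"
      using w(2) by (metis Suc_leI le_add_diff_inverse power_add)
    moreover have "coprime (2 ^ (u - Suc w)) (2 * 2 ^ w' + 1 :: nat)" by simp
    ultimately show ?thesis
      using gcd_mult_distrib_nat[of "2 ^ Suc w" "2 ^ (u - Suc w)" "2 * 2 ^ w' + 1"] by simp
  qed
  have small: "e * (1 + x) ^ 2 ^ Suc w \<doteq> e"
    using corner_power_gcd[OF n qq] unfolding gcd by simp
  have "e * (1 - x) ^ 2 \<doteq> e * (1 + x) ^ (q * 2)"
    using cong_sym[OF cong_absorb_power[OF f1, of 2]] by (simp add: power_mult)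
  also have "\<dots> = e * (1 + x) ^ 2 ^ Suc w * (1 + x) ^ 2"

  proof -
    have "q * 2 = 2 ^ Suc w + 2" by (simp add: q_def Q)
    then show ?thesis by (simp only: power_add mult.assoc)
  qed
  also have "\<dots> \<doteq> e * (1 + x) ^ 2" by (rule cong_mult_right[OF small])
  finally have "e * (1 - x) ^ 2 - e * (1 + x) ^ 2 \<in> I" by (simp add: cong_mod_def)
  then have ex: "2 ^ 2 * (e * x) \<in> I"
    by (rule mem_combination1[of _ _ "-1"]) (simp add: algebra_simps power2_eq_square)
  have "e * x \<in> I"
  proof (rule odd_multiple_mem[OF _ ex p(2)])
    show "of_nat p * (e * x) \<in> I"
      by (rule mem_combination1[OF p(3), of _ x]) (simp add: ac_simps)
  qed
  then have "x ^ (2 ^ w - 1) * (e * x) \<in> I" by (rule mult_mem)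
  moreover have "x ^ 2 ^ w = x * x ^ (2 ^ w - 1)" by (metis power_eq_if power_not_zero zero_neq_numeral)
  ultimately have "e * x ^ 2 ^ w \<in> I" by (simp add: ac_simps)
  then have "e * - 1 \<in> I" using cong_mem_iff[OF xw] by blast
  then show False using e uminus_mem[of "- e"] by simp
qed

text \<open>
  If \<open>p = 2 ^ v + 1\<close> with \<open>v < u\<close>, the preceding lemma applies to \<open>q = p\<close>, and for \<open>p = 3\<close>, where \<open>v\<close> is
  too small, to \<open>q = 9 = 2 ^ 3 + 1\<close>.
\<close>
lemma corner_prime:
  assumes r: "3 \<le> r" "r \<le> u"
    and idem: "e * e \<doteq> e" and p: "Factorial_Ring.prime p" "odd p" "of_nat p * e \<in> I" and e: "e \<notin> I"
    and eigen: "e * (g ^ 2 ^ (r - 1) + 1) \<in> I"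
  shows "Factorial_Ring.prime (2 ^ u + 1 :: nat)"
proof -
  have "r = u" using corner_top_level[OF r idem p(2,3) e eigen] .
  then have eigen': "e * (g ^ 2 ^ (u - 1) + 1) \<in> I" using eigen by simp
  obtain v where v: "0 < v" "v \<le> u" "p = 2 ^ v + 1"
    using corner_characteristic[OF idem p e] .
  have "\<not> v < u"
  proof
    assume "v < u"
    show False
    proof (cases "v = 1")
      case True
      then have "p ^ 2 = 2 ^ 3 + 1" using v by simp
      then show False using corner_fermat_prime_power_maximal[OF idem p e eigen', of 2 3] large by simp
    next
      case False
      have "p ^ 1 = 2 ^ v + 1" using v by simp
      then show False using corner_fermat_prime_power_maximal[OF idem p e eigen', of 1 v] v \<open>v < u\<close> False
        by simp
    qed
  qed
  then show ?thesis using v p(1) by simp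
qed

text \<open>
  Descent on \<open>r\<close>: a power of 2 annihilates \<open>g ^ 2 ^ r - 1\<close>, down to \<open>r = 2\<close>.
\<close>
theorem two_power_plus_one_prime: "Factorial_Ring.prime (2 ^ u + 1 :: nat)"
proof (rule ccontr)
  assume not_prime: "\<not> Factorial_Ring.prime (2 ^ u + 1 :: nat)"
  have "\<exists>j. 2 ^ j * (g ^ 2 ^ r - 1) \<in> I" if "2 \<le> r" "r \<le> u" for r
    using that(2,1)
  proof (induction r rule: inc_induct)
    case base
    show ?case using g_involution(2) by (intro exI[of _ 0]) (simp add: cong_mod_def)
  next
    case (step r)
    then obtain j where j: "2 ^ j * (g ^ 2 ^ Suc r - 1) \<in> I" by auto
    define t where "t = 2 ^ j * (g ^ 2 ^ r - 1)"
    have sq: "g ^ 2 ^ Suc r = g ^ 2 ^ r * g ^ 2 ^ r" by (simp add: mult_2 power_add)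
    have eigen: "t * (g ^ 2 ^ r + 1) \<in> I"
      by (rule mem_combination1[OF j, of _ 1]) (simp add: t_def sq algebra_simps del: power_Suc)
    have quad: "t * t + 2 ^ Suc j * t \<in> I"
      by (rule mem_combination1[OF j, of _ "2 ^ j"]) (simp only: t_def sq power_Suc[of "2 :: 'p" j], simp add: algebra_simps)
    have r: "3 \<le> Suc r" "Suc r \<le> u" using step by auto
    obtain M where M: "M > 0" "of_nat M * t \<in> I"
      using eigen_part_torsion[OF r(1) _ _ quad] eigen by auto
    show ?case
    proof (rule ccontr)
      assume none: "\<nexists>j. 2 ^ j * (g ^ 2 ^ r - 1) \<in> I"
      have "2 ^ i * t \<notin> I" for i
        using none[simplified, rule_format, of "i + j"] by (simp add: t_def power_add mult.assoc)
      then obtain p c where pc: "Factorial_Ring.prime p" "odd p" "c * t * (c * t) \<doteq> c * t"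
        "of_nat p * (c * t) \<in> I" "c * t \<notin> I"
        using odd_torsion_idempotent[OF quad M(2,1)] by metis
      have "c * t * (g ^ 2 ^ (Suc r - 1) + 1) \<in> I"
        using mult_mem[OF eigen, of c] by (simp add: mult.assoc)
      then have "Factorial_Ring.prime (2 ^ u + 1 :: nat)"
        using corner_prime[OF r pc(3,1,2,4,5)] by blast
      with not_prime show False ..
    qed
  qed
  from this[of 2] obtain j where "2 ^ j * (g ^ 4 - 1) \<in> I" using large by auto
  then show False using fourth_power_not_two_power_torsion by blast
qed

end

section \<open>Evaluating polynomials in commuting elements of a ring\<close>

text \<open>
  A homomorphism from a type-class ring into a ring that may be noncommutative; it makes the
  congruence arguments above available for the commutative subring that is its image.
\<close>
locale comm_ring_eval = ring A for A :: "'r ring" (structure) +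
  fixes \<phi> :: "'a::comm_ring_1 \<Rightarrow> 'r"
  assumes closed [simp]: "\<phi> x \<in> carrier A"
    and add: "\<phi> (x + y) = \<phi> x \<oplus> \<phi> y"
    and mult: "\<phi> (x * y) = \<phi> x \<otimes> \<phi> y"
    and one: "\<phi> 1 = \<one>"
begin

lemma zero: "\<phi> 0 = \<zero>"
  using add[of 0 0] by (metis add_0 add.l_cancel_one closed)

lemma uminus: "\<phi> (- x) = \<ominus> \<phi> x"
  using add[of "- x" x] zero by (metis add.left_inverse closed minus_equality)

lemma diff: "\<phi> (x - y) = \<phi> x \<ominus> \<phi> y"
  using add[of x "- y"] by (simp add: uminus minus_eq)

lemma power: "\<phi> (x ^ k) = \<phi> x [^] k"
proof (induction k)
  case (Suc k)
  have "\<phi> (x ^ Suc k) = \<phi> (x ^ k * x)" by (simp add: mult.commute)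
  then show ?case using Suc by (simp add: mult)
qed (simp add: one)

lemma commute: "\<phi> x \<otimes> \<phi> y = \<phi> y \<otimes> \<phi> x"
  by (metis mult mult.commute)

text \<open>
  Horner evaluation at \<open>b\<close> of a polynomial whose coefficients are first mapped by \<open>\<phi>\<close>. It is iterated
  below, first for integer coefficients and then for integer polynomials as coefficients.
\<close>
definition extend :: "'r \<Rightarrow> 'a poly \<Rightarrow> 'r"
  where "extend b p = foldr (\<lambda>a s. \<phi> a \<oplus> b \<otimes> s) (coeffs p) \<zero>"

context
  fixes b
  assumes b [simp]: "b \<in> carrier A" and b_commute: "\<And>x. b \<otimes> \<phi> x = \<phi> x \<otimes> b"
begin

lemma extend_0: "extend b 0 = \<zero>"
  by (simp add: extend_def)

lemma extend_pCons: "extend b (pCons a p) = \<phi> a \<oplus> b \<otimes> extend b p"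
  by (simp add: extend_def cCons_def zero)

lemma extend_closed [simp]: "extend b p \<in> carrier A"
  by (induction p) (simp_all add: extend_0 extend_pCons)

lemma extend_const: "extend b [:a:] = \<phi> a"
  by (simp add: extend_0 extend_pCons)

lemma extend_var: "extend b [:0, 1:] = b"
  by (simp add: extend_0 extend_pCons zero one)

lemma extend_add: "extend b (p + q) = extend b p \<oplus> extend b q"
proof (induction p q rule: poly_induct2)
  case (pCons a p c q)
  then show ?case by (simp add: extend_pCons add r_distr a_ac)
qed (simp add: extend_0)

lemma extend_commute:
  assumes "y \<in> carrier A" "y \<otimes> b = b \<otimes> y" "\<And>x. y \<otimes> \<phi> x = \<phi> x \<otimes> y"
  shows "y \<otimes> extend b p = extend b p \<otimes> y"
proof (induction p)
  case (pCons a p)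
  have "y \<otimes> (b \<otimes> extend b p) = b \<otimes> extend b p \<otimes> y"
    using assms(1,2) pCons(2) by (metis b extend_closed m_assoc)
  then show ?case using assms by (simp add: extend_pCons l_distr r_distr)
qed (simp add: extend_0 assms)

lemma extend_smult: "extend b (smult a p) = \<phi> a \<otimes> extend b p"
proof (induction p)
  case (pCons c p)
  have "b \<otimes> (\<phi> a \<otimes> extend b p) = \<phi> a \<otimes> (b \<otimes> extend b p)"
    by (metis b b_commute closed extend_closed m_assoc)
  then show ?case using pCons(2) by (simp add: extend_pCons mult r_distr)
qed (simp add: extend_0)

lemma extend_mult: "extend b (p * q) = extend b p \<otimes> extend b q"
proof (induction p)
  case (pCons a p)
  then show ?case
    by (simp add: extend_pCons extend_add extend_smult zero l_distr m_assoc)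
qed (simp add: extend_0)

lemma comm_ring_eval_extend: "comm_ring_eval A (extend b)"
proof
  show "extend b 1 = \<one>" using extend_const[of 1] by (simp add: one one_pCons)
qed (simp_all add: extend_add extend_mult)

end

end

lemma comm_ring_eval_int:
  fixes R :: "'r ring" (structure)
  assumes "ring R"
  shows "comm_ring_eval R (\<lambda>k :: int. add_pow R k \<one>)"
proof -
  interpret ring R by fact
  show ?thesis
  proof
    fix x y :: int
    show "add_pow R (x + y) \<one> = add_pow R x \<one> \<oplus> add_pow R y \<one>" by (simp add: add.int_pow_mult)
    show "add_pow R (x * y) \<one> = add_pow R x \<one> \<otimes> add_pow R y \<one>"
      by (simp add: add_pow_ldistr_int add.int_pow_pow mult.commute)
  qed simp_all
qed

lemma polynomial_evaluation_in_commuting_pair: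
  fixes R :: "'r ring" (structure)
  assumes R: "ring R" and ab: "a \<in> carrier R" "b \<in> carrier R" "a \<otimes> b = b \<otimes> a"
  obtains \<phi> :: "int poly poly \<Rightarrow> 'r" and h g
  where "comm_ring_eval R \<phi>" "\<phi> h = a" "\<phi> g = b"
proof -
  interpret ring R by (rule R)
  define \<psi> :: "int \<Rightarrow> 'r" where "\<psi> k = add_pow R k \<one>" for k
  interpret Z: comm_ring_eval R \<psi>
    using comm_ring_eval_int[OF R] unfolding \<psi>_def .
  have central: "y \<otimes> \<psi> k = \<psi> k \<otimes> y" if "y \<in> carrier R" for y k
    using that by (simp add: \<psi>_def add_pow_ldistr_int add_pow_rdistr_int)
  interpret Zb: comm_ring_eval R "Z.extend b"
    using Z.comm_ring_eval_extend[OF ab(2) central[OF ab(2)]] .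
  have comm: "a \<otimes> Z.extend b p = Z.extend b p \<otimes> a" for p
    using Z.extend_commute[OF ab(2) central[OF ab(2)] ab(1,3) central[OF ab(1)]] .
  have "comm_ring_eval R (Zb.extend a)"
    using Zb.comm_ring_eval_extend[OF ab(1) comm] .
  moreover have "Zb.extend a [:0, 1:] = a"
    using Zb.extend_var[OF ab(1) comm] .
  moreover have "Zb.extend a [:[:0, 1:]:] = b"
    using Zb.extend_const[OF ab(1) comm] Z.extend_var[OF ab(2) central[OF ab(2)]] by metis
  ultimately show ?thesis using that by blast
qed

section \<open>Generators of the unit group\<close>

text \<open>
  A presentation of the product of two cyclic groups by generators and relations, in the form in
  which it is transported along the evaluation map.
\<close>
lemma integer_mod_group_product_generators:
  assumes iso: "integer_mod_group m \<times>\<times> integer_mod_group n \<cong> units_of A"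
    and A: "ring A" and m: "1 < m" and n: "1 < n"
  obtains a b where "a \<in> Units A" "b \<in> Units A" "a \<otimes>\<^bsub>A\<^esub> b = b \<otimes>\<^bsub>A\<^esub> a"
    "\<And>x. x \<in> Units A \<Longrightarrow> \<exists>(i::nat) (j::nat). x = a [^]\<^bsub>A\<^esub> i \<otimes>\<^bsub>A\<^esub> b [^]\<^bsub>A\<^esub> j"
    "\<And>(i::nat) (j::nat). a [^]\<^bsub>A\<^esub> i \<otimes>\<^bsub>A\<^esub> b [^]\<^bsub>A\<^esub> j = \<one>\<^bsub>A\<^esub> \<longleftrightarrow> m dvd i \<and> n dvd j"
proof -
  interpret A: ring A by (rule A)
  obtain f where f: "f \<in> iso (integer_mod_group m \<times>\<times> integer_mod_group n) (units_of A)"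
    using iso by (auto simp: is_iso_def)
  have car: "carrier (integer_mod_group m \<times>\<times> integer_mod_group n) = {0..<int m} \<times> {0..<int n}"
    using m n by (simp add: DirProd_def carrier_integer_mod_group)
  have hom: "f ((x + x') mod int m, (y + y') mod int n) = f (x, y) \<otimes>\<^bsub>A\<^esub> f (x', y')"
    if "x \<in> {0..<int m}" "x' \<in> {0..<int m}" "y \<in> {0..<int n}" "y' \<in> {0..<int n}" for x x' y y'

  proof -
    have "f \<in> hom (integer_mod_group m \<times>\<times> integer_mod_group n) (units_of A)"
      using f by (simp add: iso_def)
    from hom_mult[OF this, unfolded car, of "(x, y)" "(x', y')"] that
    show ?thesis by (simp add: units_of_mult)
  qed
  have bij: "bij_betw f ({0..<int m} \<times> {0..<int n}) (Units A)"
    using f car by (simp add: iso_def units_of_def)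
  have unit: "f (x, y) \<in> Units A" if "x \<in> {0..<int m}" "y \<in> {0..<int n}" for x y
    using bij that by (auto simp: bij_betw_def)
  have f0: "f (0, 0) = \<one>\<^bsub>A\<^esub>"
    using group_hom.hom_one[of "integer_mod_group m \<times>\<times> integer_mod_group n" "units_of A" f]
      f DirProd_group[of "integer_mod_group m" "integer_mod_group n"] A.units_group
    by (simp add: group_hom_def group_hom_axioms_def iso_def units_of_one)
  define a b where "a = f (1, 0)" and "b = f (0, 1)"
  have apow: "a [^]\<^bsub>A\<^esub> i = f (int i mod int m, 0)" for i
  proof (induction i)
    case (Suc i)
    have "f ((int i mod int m + 1) mod int m, (0 + 0) mod int n) = f (int i mod int m, 0) \<otimes>\<^bsub>A\<^esub> f (1, 0)"
      using m n by (intro hom) auto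
    then show ?case using Suc by (simp add: a_def mod_simps add.commute)
  qed (simp add: f0)
  have bpow: "b [^]\<^bsub>A\<^esub> j = f (0, int j mod int n)" for j
  proof (induction j)
    case (Suc j)
    have "f ((0 + 0) mod int m, (int j mod int n + 1) mod int n) = f (0, int j mod int n) \<otimes>\<^bsub>A\<^esub> f (0, 1)"
      using m n by (intro hom) auto
    then show ?case using Suc by (simp add: b_def mod_simps add.commute)
  qed (simp add: f0)
  have monomial: "a [^]\<^bsub>A\<^esub> i \<otimes>\<^bsub>A\<^esub> b [^]\<^bsub>A\<^esub> j = f (int i mod int m, int j mod int n)" for i j
    using hom[of "int i mod int m" 0 0 "int j mod int n"] m n by (simp add: apow bpow)
  show ?thesis
  proof (rule that)
    show "a \<in> Units A" "b \<in> Units A" unfolding a_def b_def using m n by (auto intro!: unit)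
    show "a \<otimes>\<^bsub>A\<^esub> b = b \<otimes>\<^bsub>A\<^esub> a"
      using hom[of 1 0 0 1] hom[of 0 1 1 0] m n by (simp add: a_def b_def)
  next
    fix x assume "x \<in> Units A"
    then have "x \<in> f ` ({0..<int m} \<times> {0..<int n})" using bij by (simp add: bij_betw_def)
    then obtain k l where kl: "k \<in> {0..<int m}" "l \<in> {0..<int n}" "x = f (k, l)" by blast
    then have "x = a [^]\<^bsub>A\<^esub> nat k \<otimes>\<^bsub>A\<^esub> b [^]\<^bsub>A\<^esub> nat l"
      unfolding monomial by simp
    then show "\<exists>(i::nat) (j::nat). x = a [^]\<^bsub>A\<^esub> i \<otimes>\<^bsub>A\<^esub> b [^]\<^bsub>A\<^esub> j" by blast
  next
    fix i j :: nat
    have "f (int i mod int m, int j mod int n) = f (0, 0) \<longleftrightarrow> (int i mod int m, int j mod int n) = (0, 0)"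
      using bij m n by (intro inj_on_eq_iff[of f "{0..<int m} \<times> {0..<int n}"]) (auto simp: bij_betw_def)
    then show "a [^]\<^bsub>A\<^esub> i \<otimes>\<^bsub>A\<^esub> b [^]\<^bsub>A\<^esub> j = \<one>\<^bsub>A\<^esub> \<longleftrightarrow> m dvd i \<and> n dvd j"
      by (simp add: monomial f0 flip: dvd_eq_mod_eq_0)
  qed
qed

section \<open>Products of the unit groups of two finite fields\<close>


lemma units_of_RDirProd:
  assumes "ring R" "ring S"
  shows "units_of (RDirProd R S) \<cong> units_of R \<times>\<times> units_of S"
proof -
  have "Units (RDirProd R S) = Units R \<times> Units S"
    unfolding Units_def RDirProd_def DirProd_def by (auto simp: monoid.defs)
  then have "id \<in> iso (units_of (RDirProd R S)) (units_of R \<times>\<times> units_of S)"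
    by (auto simp: iso_def hom_def bij_betw_def units_of_def DirProd_def RDirProd_def monoid.defs)
  then show ?thesis by (rule is_isoI)
qed

lemma (in field) units_of_finite_field_cyclic:
  assumes "finite (carrier R)" "card (carrier R) = Suc m"
  shows "integer_mod_group m \<cong> units_of R"
proof -
  interpret M: group "Multiplicative_Group.mult_of R" by (rule field_mult_group)
  have m: "Coset.order (Multiplicative_Group.mult_of R) = m" using order_mult_of[OF assms(1)] assms(2) by (simp add: Coset.order_def)
  have fin: "finite (carrier (Multiplicative_Group.mult_of R))" using assms(1) by (rule finite_mult_of)
  have m0: "m > 0" using m M.order_gt_0_iff_finite fin by blast
  obtain a where a: "a \<in> carrier (Multiplicative_Group.mult_of R)" "carrier (Multiplicative_Group.mult_of R) = {a [^] i | i::nat. i \<in> UNIV}"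
    using finite_field_mult_group_has_gen[OF assms(1)] by blast
  have "carrier (Multiplicative_Group.mult_of R) \<subseteq> generate (Multiplicative_Group.mult_of R) {a}"

  proof
    fix x assume "x \<in> carrier (Multiplicative_Group.mult_of R)"
    then obtain i :: nat where "x = a [^] i" using a(2) by blast
    then have "x = a [^]\<^bsub>Multiplicative_Group.mult_of R\<^esub> int i"
      by (simp add: Multiplicative_Group.nat_pow_mult_of int_pow_int)
    then show "x \<in> generate (Multiplicative_Group.mult_of R) {a}"
      unfolding M.generate_pow[OF a(1)] by blast
  qed
  then have "generate (Multiplicative_Group.mult_of R) {a} = carrier (Multiplicative_Group.mult_of R)"
    using M.generate_incl[of "{a}"] a(1) by auto
  then have ord: "M.ord a = m"
    using M.generate_pow_card[OF a(1)] m by (simp add: Coset.order_def)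
  define f where "f k = a [^]\<^bsub>Multiplicative_Group.mult_of R\<^esub> (k :: int)" for k
  have closed: "f k \<in> carrier (Multiplicative_Group.mult_of R)" for k
    unfolding f_def using a(1) by (rule M.int_pow_closed)
  have eq: "f k = f l \<longleftrightarrow> int m dvd l - k" for k l
    using M.int_pow_eq[OF a(1)] by (simp add: f_def ord)
  have car: "carrier (integer_mod_group m) = {0..<int m}"
    using m0 by (simp add: carrier_integer_mod_group)
  have inj: "inj_on f {0..<int m}"
  proof (rule inj_onI)
    fix k l assume "k \<in> {0..<int m}" "l \<in> {0..<int m}" "f k = f l"
    then show "k = l" using eq by (auto simp: mod_eq_dvd_iff[symmetric])
  qed
  then have "card (f ` {0..<int m}) = card (carrier (Multiplicative_Group.mult_of R))"
    using m by (simp add: card_image Coset.order_def)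
  then have "f ` {0..<int m} = carrier (Multiplicative_Group.mult_of R)"
    using fin closed by (intro card_subset_eq) auto
  moreover have "f ((k + l) mod int m) = f k \<otimes>\<^bsub>Multiplicative_Group.mult_of R\<^esub> f l" for k l
  proof -
    have "f ((k + l) mod int m) = f (k + l)" by (simp add: eq flip: mod_eq_dvd_iff)
    then show ?thesis unfolding f_def using M.int_pow_mult[OF a(1)] by simp
  qed
  ultimately have "f \<in> iso (integer_mod_group m) (Multiplicative_Group.mult_of R)"
    using inj closed by (simp add: iso_def hom_def bij_betw_def car)
  then show ?thesis unfolding mult_of_is_Units by (rule is_isoI)
qed

lemma realisable_cyclic_product:
  fixes R :: "'a ring" and S :: "'b ring"
  assumes "field R" "finite (carrier R)" "card (carrier R) = Suc m"
    and "field S" "finite (carrier S)" "card (carrier S) = Suc n"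
  shows "realisable TYPE('a \<times> 'b) (integer_mod_group m \<times>\<times> integer_mod_group n)"
proof -
  interpret R: field R by (rule assms)
  interpret S: field S by (rule assms)
  have "integer_mod_group m \<times>\<times> integer_mod_group n \<cong> units_of R \<times>\<times> units_of S"
    using R.units_of_finite_field_cyclic[OF assms(2,3)] S.units_of_finite_field_cyclic[OF assms(5,6)]
    by (intro group.DirProd_iso_trans) auto
  also have "units_of R \<times>\<times> units_of S \<cong> units_of (RDirProd R S)"
  proof (rule group.iso_sym)
    have "ring (RDirProd R S)" by (intro RDirProd_ring R.ring_axioms S.ring_axioms)
    then show "group (units_of (RDirProd R S))" by (simp add: ring_def monoid.units_group)
    show "units_of (RDirProd R S) \<cong> units_of R \<times>\<times> units_of S"
      by (intro units_of_RDirProd R.ring_axioms S.ring_axioms)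
  qed
  finally show ?thesis
    unfolding realisable_def using RDirProd_ring[OF R.ring_axioms S.ring_axioms] by blast
qed

section \<open>The field with nine elements\<close>

text \<open>
  The Gaussian integers modulo 3: the pair \<open>(a, b)\<close> stands for \<open>a + b i\<close> with \<open>i\<^sup>2 = -1\<close>.
\<close>
definition F9 :: "(int \<times> int) ring"
  where "F9 = \<lparr>carrier = {0..2} \<times> {0..2},
     monoid.mult = (\<lambda>(a, b) (c, d). ((a * c - b * d) mod 3, (a * d + b * c) mod 3)),
     one = (1, 0), ring.zero = (0, 0), ring.add = (\<lambda>(a, b) (c, d). ((a + c) mod 3, (b + d) mod 3))\<rparr>"

lemma F9_field: "field F9"
proof -
  have reduce: "(a * (x mod 3) + b * (y mod 3)) mod 3 = (a * x + b * y) mod 3"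
    "(a * (x mod 3) - b * (y mod 3)) mod 3 = (a * x - b * y) mod 3"
    "((x mod 3) * a + (y mod 3) * b) mod 3 = (x * a + y * b) mod 3"
    "((x mod 3) * a - (y mod 3) * b) mod 3 = (x * a - y * b) mod 3" for a b x y :: int
    by (intro mod_add_cong mod_diff_cong; simp add: mod_mult_left_eq mod_mult_right_eq)+
  have group: "abelian_group F9"
  proof (rule abelian_groupI)
    fix x y assume "x \<in> carrier F9" "y \<in> carrier F9"
    then show "x \<oplus>\<^bsub>F9\<^esub> y \<in> carrier F9" by (auto simp: F9_def)
    show "x \<oplus>\<^bsub>F9\<^esub> y = y \<oplus>\<^bsub>F9\<^esub> x" by (simp add: F9_def split_beta add.commute)
  next
    fix x y z
    show "x \<oplus>\<^bsub>F9\<^esub> y \<oplus>\<^bsub>F9\<^esub> z = x \<oplus>\<^bsub>F9\<^esub> (y \<oplus>\<^bsub>F9\<^esub> z)"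
      by (simp add: F9_def split_beta mod_add_left_eq mod_add_right_eq add.assoc)
  next
    fix x assume "x \<in> carrier F9"
    then show "\<zero>\<^bsub>F9\<^esub> \<oplus>\<^bsub>F9\<^esub> x = x" by (auto simp: F9_def)
    show "\<exists>y\<in>carrier F9. y \<oplus>\<^bsub>F9\<^esub> x = \<zero>\<^bsub>F9\<^esub>"
      by (rule bexI[of _ "((- fst x) mod 3, (- snd x) mod 3)"])
        (auto simp: F9_def split_beta mod_add_left_eq)
  qed (simp add: F9_def)
  have assoc: "x \<otimes>\<^bsub>F9\<^esub> y \<otimes>\<^bsub>F9\<^esub> z = x \<otimes>\<^bsub>F9\<^esub> (y \<otimes>\<^bsub>F9\<^esub> z)" for x y z
    by (simp add: F9_def split_beta reduce) (simp add: algebra_simps)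
  have monoid: "Group.comm_monoid F9"
  proof (rule comm_monoidI)
    fix x y assume "x \<in> carrier F9" "y \<in> carrier F9"
    then show "x \<otimes>\<^bsub>F9\<^esub> y \<in> carrier F9" by (auto simp: F9_def)
    show "x \<otimes>\<^bsub>F9\<^esub> y = y \<otimes>\<^bsub>F9\<^esub> x" by (simp add: F9_def split_beta ac_simps)
  next
    fix x assume "x \<in> carrier F9"
    then show "\<one>\<^bsub>F9\<^esub> \<otimes>\<^bsub>F9\<^esub> x = x" by (auto simp: F9_def)
  qed (simp_all add: assoc, simp add: F9_def)
  interpret cring F9
  proof (rule cringI[OF group monoid])
    fix x y z
    show "(x \<oplus>\<^bsub>F9\<^esub> y) \<otimes>\<^bsub>F9\<^esub> z = x \<otimes>\<^bsub>F9\<^esub> z \<oplus>\<^bsub>F9\<^esub> y \<otimes>\<^bsub>F9\<^esub> z"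
      by (simp add: F9_def split_beta reduce mod_add_eq) (simp add: algebra_simps)
  qed
  show ?thesis
  proof (rule cring_fieldI2)
    fix x assume "x \<in> carrier F9" "x \<noteq> \<zero>\<^bsub>F9\<^esub>"
    then obtain a b where ab: "x = (a, b)" "0 \<le> a" "a \<le> 2" "0 \<le> b" "b \<le> 2" "a \<noteq> 0 \<or> b \<noteq> 0"
      by (cases x) (auto simp: F9_def)
    then have x: "x = (a, b)" "a = 0 \<or> a = 1 \<or> a = 2" "b = 0 \<or> b = 1 \<or> b = 2" "a \<noteq> 0 \<or> b \<noteq> 0"
      by linarith+
    \<comment> \<open>The inverse is the conjugate divided by the norm \<open>s\<close>, and \<open>s\<close> is its own inverse modulo 3.\<close>
    define s where "s = a * a + b * b"
    have "s * s mod 3 = 1" using x(2-4) by (auto simp: s_def)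
    moreover have "(a * (a * s) - b * (- b * s)) mod 3 = s * s mod 3" by (simp add: s_def algebra_simps)
    moreover have "a * (- b * s) + b * (a * s) = 0" by simp
    ultimately have "x \<otimes>\<^bsub>F9\<^esub> ((a * s) mod 3, (- b * s) mod 3) = \<one>\<^bsub>F9\<^esub>"
      by (simp only: F9_def x(1) reduce split_beta monoid.simps fst_conv snd_conv) simp
    moreover have "y mod 3 \<le> 2" for y :: int
      using pos_mod_bound[of 3 y] by linarith
    then have "((a * s) mod 3, (- b * s) mod 3) \<in> carrier F9" by (simp add: F9_def)
    ultimately show "\<exists>y\<in>carrier F9. x \<otimes>\<^bsub>F9\<^esub> y = \<one>\<^bsub>F9\<^esub>" by blast
  qed (simp add: F9_def)
qed

lemma residue_field:
  assumes "Factorial_Ring.prime p"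
  shows "field (residue_ring (int p))" "finite (carrier (residue_ring (int p)))"
    "card (carrier (residue_ring (int p))) = Suc (p - 1)"
proof -
  interpret residues_prime p "residue_ring (int p)"
    using assms by unfold_locales simp_all
  show "field (residue_ring (int p))" by (rule is_field)
  show "finite (carrier (residue_ring (int p)))" by simp
  show "card (carrier (residue_ring (int p))) = Suc (p - 1)"
    using prime_gt_0_nat[OF assms] by (simp add: res_carrier_eq)
qed

text \<open>
  The rings built here live on pairs of integers; a countable type embeds into every infinite one.
\<close>
lemma realisable_countable_transfer:
  assumes "infinite (UNIV :: 'r set)" and "realisable TYPE('a::countable) G"
  shows "realisable TYPE('r) G"
proof -
  obtain f :: "nat \<Rightarrow> 'r" where "inj f"
    using infinite_countable_subset[OF assms(1)] by blast
  then have "inj (f \<circ> (to_nat :: 'a \<Rightarrow> nat))" by (simp add: inj_compose)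
  then show ?thesis using assms(2) by (rule realisable_transfer)
qed

text \<open>
  A field with five elements contributes the factor of order 4. A field with \<open>2 ^ u + 1\<close> elements
  contributes the other factor, and one exists if this number is a prime or equals 9.
\<close>
lemma realisable_if_prime_or_nine:
  assumes "infinite (UNIV :: 'r set)" and "Factorial_Ring.prime (2 ^ u + 1 :: nat) \<or> u = 3"
  shows "realisable TYPE('r) (integer_mod_group 4 \<times>\<times> integer_mod_group (2 ^ u))"
proof -
  have "Factorial_Ring.prime (5 :: nat)" by simp
  note five = residue_field[OF this]
  show ?thesis
  proof (cases "u = 3")
    case True
    have "carrier F9 = {0..2} \<times> {0..2}" by (simp add: F9_def)
    then have nine: "finite (carrier F9)" "card (carrier F9) = Suc (2 ^ u)" by (simp_all add: True)
    have "realisable TYPE(int \<times> int \<times> int) (integer_mod_group 4 \<times>\<times> integer_mod_group (2 ^ u))"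
      using realisable_cyclic_product[OF five(1,2) _ F9_field nine] five(3) by simp
    then show ?thesis by (rule realisable_countable_transfer[OF assms(1)])
  next
    case False
    then have "Factorial_Ring.prime (2 ^ u + 1 :: nat)" using assms(2) by simp
    note p = residue_field[OF this]
    have "realisable TYPE(int \<times> int) (integer_mod_group 4 \<times>\<times> integer_mod_group (2 ^ u))"
      using realisable_cyclic_product[OF five(1,2) _ p(1,2)] five(3) p(3) by simp
    then show ?thesis by (rule realisable_countable_transfer[OF assms(1)])
  qed
qed

section \<open>Realisable groups\<close>

text \<open>
  The ideal \<open>I\<close> is the kernel of the evaluation of polynomials at the generators of the unit group.
  Units modulo \<open>I\<close> are exactly the polynomials that are mapped to units, since all units lie in the
  image.
\<close>
lemma prime_of_units_iso:
  fixes A :: "'r ring"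
  assumes A: "ring A" and iso: "integer_mod_group 4 \<times>\<times> integer_mod_group (2 ^ u) \<cong> units_of A"
    and u: "4 \<le> u"
  shows "Factorial_Ring.prime (2 ^ u + 1 :: nat)"
proof -
  interpret A: ring A by (rule A)
  have "(1::nat) < 2 ^ u" using u by (intro one_less_power) auto
  then obtain a b where ab: "a \<in> Units A" "b \<in> Units A" "a \<otimes>\<^bsub>A\<^esub> b = b \<otimes>\<^bsub>A\<^esub> a"
    and gen: "\<And>x. x \<in> Units A \<Longrightarrow> \<exists>(i::nat) (j::nat). x = a [^]\<^bsub>A\<^esub> i \<otimes>\<^bsub>A\<^esub> b [^]\<^bsub>A\<^esub> j"
    and rel: "\<And>(i::nat) (j::nat). a [^]\<^bsub>A\<^esub> i \<otimes>\<^bsub>A\<^esub> b [^]\<^bsub>A\<^esub> j = \<one>\<^bsub>A\<^esub> \<longleftrightarrow> 4 dvd i \<and> 2 ^ u dvd j"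
    using integer_mod_group_product_generators[OF iso A] by auto
  obtain \<phi> :: "int poly poly \<Rightarrow> 'r" and h g
    where \<phi>: "comm_ring_eval A \<phi>" and h: "\<phi> h = a" and g: "\<phi> g = b"
    using polynomial_evaluation_in_commuting_pair[OF A A.Units_closed[OF ab(1)] A.Units_closed[OF ab(2)] ab(3)] .
  interpret \<phi>: comm_ring_eval A \<phi> by (rule \<phi>)
  define I where "I = {p. \<phi> p = \<zero>\<^bsub>A\<^esub>}"
  interpret congruence_ideal I
    by unfold_locales (simp_all add: I_def \<phi>.zero \<phi>.add \<phi>.mult)
  have cong: "cong_mod p q \<longleftrightarrow> \<phi> p = \<phi> q" for p q
    unfolding cong_mod_def by (simp add: I_def \<phi>.diff)
  have monomial: "\<phi> (h ^ i * g ^ j) = a [^]\<^bsub>A\<^esub> i \<otimes>\<^bsub>A\<^esub> b [^]\<^bsub>A\<^esub> j" for i j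
    by (simp add: \<phi>.mult \<phi>.power h g)
  interpret monomial_units I g h u
  proof
    fix c d assume "cong_mod (c * d) 1"
    then have "\<phi> c \<otimes>\<^bsub>A\<^esub> \<phi> d = \<one>\<^bsub>A\<^esub>" by (simp add: cong \<phi>.mult \<phi>.one)
    moreover from this have "\<phi> d \<otimes>\<^bsub>A\<^esub> \<phi> c = \<one>\<^bsub>A\<^esub>" by (simp add: \<phi>.commute)
    ultimately have "\<phi> c \<in> Units A" unfolding Units_def by (auto intro!: bexI[of _ "\<phi> d"])
    then show "\<exists>i j. cong_mod c (h ^ i * g ^ j)" using gen by (simp add: cong monomial)
  next
    fix i j
    show "cong_mod (h ^ i * g ^ j) 1 \<longleftrightarrow> 4 dvd i \<and> 2 ^ u dvd j"
      by (simp add: cong monomial \<phi>.one rel)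
  qed (rule u)
  show ?thesis by (rule two_power_plus_one_prime)
qed

theorem theorem7p6:
  fixes u :: nat
  assumes "infinite (UNIV :: 'r set)"
  shows "realisable TYPE('r) (integer_mod_group 4 \<times>\<times> integer_mod_group (2 ^ u))
    \<longleftrightarrow> u \<le> 3 \<or> fermat_prime (2 ^ u + 1)"
proof
  assume "realisable TYPE('r) (integer_mod_group 4 \<times>\<times> integer_mod_group (2 ^ u))"
  then obtain A :: "'r ring" where "ring A" "integer_mod_group 4 \<times>\<times> integer_mod_group (2 ^ u) \<cong> units_of A"
    unfolding realisable_def by blast
  then have "Factorial_Ring.prime (2 ^ u + 1 :: nat)" if "4 \<le> u"
    using prime_of_units_iso that by blast
  then show "u \<le> 3 \<or> fermat_prime (2 ^ u + 1)"
    unfolding fermat_prime_def by (cases "u \<le> 3") auto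
next
  have "Factorial_Ring.prime (2 :: nat)" "Factorial_Ring.prime (3 :: nat)" "Factorial_Ring.prime (5 :: nat)"
    by simp_all
  then have "Factorial_Ring.prime (2 ^ u + 1 :: nat) \<or> u = 3" if "u \<le> 3"
  proof -
    have "u = 0 \<or> u = 1 \<or> u = 2 \<or> u = 3" using that by auto
    then show ?thesis by (auto simp flip: numeral_2_eq_2)
  qed
  moreover assume "u \<le> 3 \<or> fermat_prime (2 ^ u + 1)"
  ultimately have "Factorial_Ring.prime (2 ^ u + 1 :: nat) \<or> u = 3"
    unfolding fermat_prime_def by blast
  then show "realisable TYPE('r) (integer_mod_group 4 \<times>\<times> integer_mod_group (2 ^ u))"
    by (rule realisable_if_prime_or_nine[OF assms])
qed

end
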